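(* Let $m,n,p,q$ be integers with $0\le m\le q$, $0\le n\le p$, let $a_i,b_j\in\mathbb{C}$ and $\alpha_i,\beta_j>0$ ($1\le i\le p$, $1\le j\le q$), and let $\Delta$, $H^{m,n}_{p,q}(z)$ and $h_{ik}$ be as defined in the context. Assume $$\beta_j(a_i-1-k)\ne\alpha_i(b_j+l)\qquad(i=1,\dots,n;\ j=1,\dots,m;\ k,l\in\mathbb N_0),$$ $$\alpha_j(1-a_i+k)\ne\alpha_i(1-a_j+l)\qquad(i\ne j;\ i,j=1,\dots,n;\ k,l\in\mathbb N_0),$$ and $\Delta<0$. Then the series $\sum_{i=1}^n\sum_{k=0}^\infty h_{ik}z^{(a_i-k-1)/\alpha_i}$ gives the asymptotic expansion of $H^{m,n}_{p,q}(z)$ near infinity, and the main terms of this asymptotic formula have the form $$H^{m,n}_{p,q}(z)=\sum_{i=1}^n\left[h_iz^{(a_i-1)/\alpha_i}+O\!\left(z^{(a_i-2)/\alpha_i}\right)\right]\qquad(|z|\to\infty),$$ where $$h_i\equiv h_{i0}=\frac1{\alpha_i}\ \frac{\prod_{j=1}^m\Gamma\!\left(b_j-[a_i-1]\frac{\beta_j}{\alpha_i}\right)\prod_{j=1,\,j\ne i}^n\Gamma\!\left(1-a_j+[a_i-1]\frac{\alpha_j}{\alpha_i}\right)}{\prod_{j=n+1}^p\Gamma\!\left(a_j-[a_i-1]\frac{\alpha_j}{\alpha_i}\right)\prod_{j=m+1}^q\Gamma\!\left(1-b_j+[a_i-1]\frac{\beta_j}{\alpha_i}\right)} .$$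
   Context: $\mathbb N_0=\{0,1,2,\dots\}$. Definitions (empty products equal $1$, and $1/\Gamma$ is entire, so $1/\Gamma=0$ at the poles of $\Gamma$): $$\mathcal H(s)=\frac{\prod_{j=1}^m\Gamma(b_j+\beta_js)\ \prod_{i=1}^n\Gamma(1-a_i-\alpha_is)}{\prod_{i=n+1}^p\Gamma(a_i+\alpha_is)\ \prod_{j=m+1}^q\Gamma(1-b_j-\beta_js)},\qquad \Delta=\sum_{j=1}^q\beta_j-\sum_{i=1}^p\alpha_i,$$ $$H^{m,n}_{p,q}(z)=\frac1{2\pi i}\int_{\mathfrak L_{+\infty}}\mathcal H(s)z^{-s}\,ds\qquad(z\ne0).$$ $\mathfrak L_{+\infty}$ is a loop running from $+\infty+i\varphi_1$ to $+\infty+i\varphi_2$, $\varphi_1<\varphi_2$ (consisting of the half-lines $\operatorname{Im}s=\varphi_1,\varphi_2$ for $\operatorname{Re}s$ sufficiently large), with all poles of $\Gamma(b_j+\beta_js)$ ($1\le j\le m$) to its left (outside the loop) and all poles of $\Gamma(1-a_i-\alpha_is)$ ($1\le i\le n$) to its right (inside the loop). The coefficients are $$h_{ik}=\frac{(-1)^k}{k!\,\alpha_i}\ \frac{\prod_{j=1}^m\Gamma\!\left(b_j+[1-a_i+k]\frac{\beta_j}{\alpha_i}\right)\prod_{j=1,\,j\ne i}^n\Gamma\!\left(1-a_j-[1-a_i+k]\frac{\alpha_j}{\alpha_i}\right)}{\prod_{j=n+1}^p\Gamma\!\left(a_j+[1-a_i+k]\frac{\alpha_j}{\alpha_i}\right)\prod_{j=m+1}^q\Gamma\!\left(1-b_j-[1-a_i+k]\frac{\beta_j}{\alpha_i}\right)}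 .$$ Powers are $z^{c}=\exp(c\log z)$ with a fixed branch of $\log z=\log|z|+i\arg z$ for which $\arg z$ stays bounded (e.g. the principal branch); $O(g(z))$ denotes a function bounded in modulus by $C|g(z)|$ for $|z|$ sufficiently large. *)

theory Defs
  imports "HOL-Complex_Analysis.Complex_Analysis" "HOL-Library.Landau_Symbols"
begin

(* A choice of log z for every nonzero z with bounded argument. Continuity is not required, so this
   covers the principal branch Ln including its cut, and every other cut and determination. *)
definition log_branch :: "(complex \<Rightarrow> complex) \<Rightarrow> bool" where
  "log_branch lg \<longleftrightarrow> (\<forall>z. z \<noteq> 0 \<longrightarrow> exp (lg z) = z) \<and> bounded ((\<lambda>z. Im (lg z)) ` (- {0}))"

definition zpow :: "(complex \<Rightarrow> complex) \<Rightarrow> complex \<Rightarrow> complex \<Rightarrow> complex" where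
  "zpow lg z c = exp (c * lg z)"

(* Gamma functions in a denominator are written with the entire function rGamma = 1 / Gamma. *)
definition fox_kernel ::
  "nat \<Rightarrow> nat \<Rightarrow> nat \<Rightarrow> nat \<Rightarrow> (nat \<Rightarrow> complex) \<Rightarrow> (nat \<Rightarrow> real) \<Rightarrow> (nat \<Rightarrow> complex) \<Rightarrow> (nat \<Rightarrow> real)
    \<Rightarrow> complex \<Rightarrow> complex" where
  "fox_kernel m n p q a \<alpha> b \<beta> s =
     (\<Prod>j=1..m. Gamma (b j + of_real (\<beta> j) * s)) *
     (\<Prod>i=1..n. Gamma (1 - a i - of_real (\<alpha> i) * s)) *
     (\<Prod>i=n+1..p. rGamma (a i + of_real (\<alpha> i) * s)) *
     (\<Prod>j=m+1..q. rGamma (1 - b j - of_real (\<beta> j) * s))"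

definition fox_Delta :: "nat \<Rightarrow> nat \<Rightarrow> (nat \<Rightarrow> real) \<Rightarrow> (nat \<Rightarrow> real) \<Rightarrow> real" where
  "fox_Delta p q \<alpha> \<beta> = (\<Sum>j=1..q. \<beta> j) - (\<Sum>i=1..p. \<alpha> i)"

(* The infinite loop comes in along the half-line Im s = \<phi>1, Re s \<ge> R, follows the finite path \<gamma>,
   and leaves along Im s = \<phi>2, Re s \<ge> R. Here it is cut off at Re s = T on both half-lines. *)
definition loop_upto ::
  "real \<Rightarrow> real \<Rightarrow> real \<Rightarrow> (real \<Rightarrow> complex) \<Rightarrow> real \<Rightarrow> real \<Rightarrow> complex" where
  "loop_upto \<phi>1 \<phi>2 R \<gamma> T =
     linepath (Complex T \<phi>1) (Complex R \<phi>1) +++ \<gamma> +++ linepath (Complex R \<phi>2) (Complex T \<phi>2)"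

definition closed_loop_upto ::
  "real \<Rightarrow> real \<Rightarrow> real \<Rightarrow> (real \<Rightarrow> complex) \<Rightarrow> real \<Rightarrow> real \<Rightarrow> complex" where
  "closed_loop_upto \<phi>1 \<phi>2 R \<gamma> T =
     loop_upto \<phi>1 \<phi>2 R \<gamma> T +++ linepath (Complex T \<phi>2) (Complex T \<phi>1)"

definition infinite_loop :: "real \<Rightarrow> real \<Rightarrow> real \<Rightarrow> (real \<Rightarrow> complex) \<Rightarrow> bool" where
  "infinite_loop \<phi>1 \<phi>2 R \<gamma> \<longleftrightarrow>
     \<phi>1 < \<phi>2 \<and> valid_path \<gamma> \<and> arc \<gamma> \<and>
     pathstart \<gamma> = Complex R \<phi>1 \<and> pathfinish \<gamma> = Complex R \<phi>2 \<and>
     path_image \<gamma> \<inter> {s. Im s = \<phi>1 \<and> R \<le> Re s} = {Complex R \<phi>1} \<and>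
     path_image \<gamma> \<inter> {s. Im s = \<phi>2 \<and> R \<le> Re s} = {Complex R \<phi>2}"

(* The two sides of the infinite loop: once T exceeds Re w and every Re s on \<gamma>, the position of w
   relative to the Jordan curve closed off at Re s = T no longer depends on T. *)
definition inside_loop ::
  "real \<Rightarrow> real \<Rightarrow> real \<Rightarrow> (real \<Rightarrow> complex) \<Rightarrow> complex \<Rightarrow> bool" where
  "inside_loop \<phi>1 \<phi>2 R \<gamma> w \<longleftrightarrow>
     (\<forall>\<^sub>F T in at_top. w \<in> inside (path_image (closed_loop_upto \<phi>1 \<phi>2 R \<gamma> T)))"

definition outside_loop ::
  "real \<Rightarrow> real \<Rightarrow> real \<Rightarrow> (real \<Rightarrow> complex) \<Rightarrow> complex \<Rightarrow> bool" where
  "outside_loop \<phi>1 \<phi>2 R \<gamma> w \<longleftrightarrow>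
     (\<forall>\<^sub>F T in at_top. w \<in> outside (path_image (closed_loop_upto \<phi>1 \<phi>2 R \<gamma> T)))"

definition fox_loop ::
  "nat \<Rightarrow> nat \<Rightarrow> (nat \<Rightarrow> complex) \<Rightarrow> (nat \<Rightarrow> real) \<Rightarrow> (nat \<Rightarrow> complex) \<Rightarrow> (nat \<Rightarrow> real)
    \<Rightarrow> real \<Rightarrow> real \<Rightarrow> real \<Rightarrow> (real \<Rightarrow> complex) \<Rightarrow> bool" where
  "fox_loop m n a \<alpha> b \<beta> \<phi>1 \<phi>2 R \<gamma> \<longleftrightarrow>
     infinite_loop \<phi>1 \<phi>2 R \<gamma> \<and>
     (\<forall>j\<in>{1..m}. \<forall>s. b j + of_real (\<beta> j) * s \<in> \<int>\<^sub>\<le>\<^sub>0 \<longrightarrow> outside_loop \<phi>1 \<phi>2 R \<gamma> s) \<and>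
     (\<forall>i\<in>{1..n}. \<forall>s. 1 - a i - of_real (\<alpha> i) * s \<in> \<int>\<^sub>\<le>\<^sub>0 \<longrightarrow> inside_loop \<phi>1 \<phi>2 R \<gamma> s)"

definition fox_H ::
  "nat \<Rightarrow> nat \<Rightarrow> nat \<Rightarrow> nat \<Rightarrow> (nat \<Rightarrow> complex) \<Rightarrow> (nat \<Rightarrow> real) \<Rightarrow> (nat \<Rightarrow> complex) \<Rightarrow> (nat \<Rightarrow> real)
    \<Rightarrow> real \<Rightarrow> real \<Rightarrow> real \<Rightarrow> (real \<Rightarrow> complex) \<Rightarrow> (complex \<Rightarrow> complex) \<Rightarrow> complex \<Rightarrow> complex" where
  "fox_H m n p q a \<alpha> b \<beta> \<phi>1 \<phi>2 R \<gamma> lg z =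
     1 / (2 * of_real pi * \<i>) *
     Lim at_top (\<lambda>T. contour_integral (loop_upto \<phi>1 \<phi>2 R \<gamma> T)
                       (\<lambda>s. fox_kernel m n p q a \<alpha> b \<beta> s * zpow lg z (- s)))"

definition fox_coeff ::
  "nat \<Rightarrow> nat \<Rightarrow> nat \<Rightarrow> nat \<Rightarrow> (nat \<Rightarrow> complex) \<Rightarrow> (nat \<Rightarrow> real) \<Rightarrow> (nat \<Rightarrow> complex) \<Rightarrow> (nat \<Rightarrow> real)
    \<Rightarrow> nat \<Rightarrow> nat \<Rightarrow> complex" where
  "fox_coeff m n p q a \<alpha> b \<beta> i k =
     (- 1) ^ k / (fact k * of_real (\<alpha> i)) *
     (\<Prod>j=1..m. Gamma (b j + (1 - a i + of_nat k) * of_real (\<beta> j / \<alpha> i))) *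
     (\<Prod>j\<in>{1..n} - {i}. Gamma (1 - a j - (1 - a i + of_nat k) * of_real (\<alpha> j / \<alpha> i))) *
     (\<Prod>j=n+1..p. rGamma (a j + (1 - a i + of_nat k) * of_real (\<alpha> j / \<alpha> i))) *
     (\<Prod>j=m+1..q. rGamma (1 - b j - (1 - a i + of_nat k) * of_real (\<beta> j / \<alpha> i)))"

(* The formal series of terms c t * z^(e t), t \<in> I, is a Poincare asymptotic expansion of f as
   |z| tends to infinity. No convergence of the series is claimed. *)
definition asymp_power_expansion ::
  "(complex \<Rightarrow> complex) \<Rightarrow> 'i set \<Rightarrow> ('i \<Rightarrow> complex) \<Rightarrow> ('i \<Rightarrow> complex) \<Rightarrow> (complex \<Rightarrow> complex) \<Rightarrow> bool"
  where
  "asymp_power_expansion lg I c e f \<longleftrightarrow>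
     (\<forall>\<rho>::real. finite {t \<in> I. \<rho> \<le> Re (e t)} \<and>
        (\<lambda>z. f z - (\<Sum>t\<in>{t \<in> I. \<rho> \<le> Re (e t)}. c t * zpow lg z (e t)))
          \<in> o[at_infinity](\<lambda>z. of_real (norm z powr \<rho>)))"

end

theory Submission imports Defs "HOL-Real_Asymp.Real_Asymp" begin

text \<open>Reflection turns every Gamma factor of the kernel into a Gamma function of an argument with
  large positive real part, times a factor that is bounded on horizontal lines avoiding the poles.
  The recursion for Gamma then shows that the kernel decays like exp (Delta x ln x + O(x)) along the
  two half-lines of the loop, so for negative Delta the loop integral converges. Cutting the loop at Re s = T and
  closing it up there yields minus the residues at the poles of the Gamma (1 - a - alpha s) with real
  part below T; what is left over lies in Re s >= T and is O(|z| powr (- T)).\<close>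

section \<open>Growth of Gamma functions in horizontal strips\<close>

text \<open>Since Delta < 0, the term Delta x ln x beats every linear term, so Gamma has to be known
  only up to factors exp (O(x)); the recursion and one compact rectangle give exactly this
  precision. The obstacle is the poles of Gamma (1 - a - \<alpha> s), which march to the right
  inside the loop: an edge Re s = T may pass close to one of them, and no bound uniform in T is
  available there. For n > 0, decay is therefore used on the two boundary lines only, and the kernel
  on the edge enters through a constant D that may depend on T; an expansion to a given order needs
  just one T. Signs: the loop with its closing edge runs clockwise, and 1 - a_i - \<alpha>_i s has
  slope -\<alpha>_i. The two minus signs cancel, so the coefficients appear with a plus. In each
  contour integral z is fixed, so the branch enters only through the number \<open>lg z\<close>; the
  bounded argument makes |z^(-s)| comparable with |z|^(-Re s) on the strip of the
  half-lines.\<close>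

lemma ln_norm_Gamma_plus1_deviation:
  fixes z :: complex
  assumes "1 \<le> Re z" "\<bar>Im z\<bar> \<le> Y"
  shows "\<bar>(ln (norm (Gamma (z + 1))) - Re (z + 1) * ln (Re (z + 1))) -
          (ln (norm (Gamma z)) - Re z * ln (Re z))\<bar> \<le> Y + 2"
proof -
  define x where "x = Re z"
  have x: "1 \<le> x" using assms by (simp add: x_def)
  have zn: "z \<notin> \<int>\<^sub>\<le>\<^sub>0" using assms by (auto elim!: nonpos_Ints_cases)
  have "z \<noteq> 0" using assms by auto
  have G: "ln (norm (Gamma (z + 1))) = ln (norm z) + ln (norm (Gamma z))"
    using zn \<open>z \<noteq> 0\<close> by (simp add: Gamma_plus1 norm_mult ln_mult Gamma_eq_zero_iff)
  have lo: "x \<le> norm z" unfolding x_def by (rule complex_Re_le_cmod)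
  have hi: "norm z \<le> x + Y" using cmod_le[of z] assms by (simp add: x_def)
  have "Y \<ge> 0" using assms by linarith
  have l1: "ln x \<le> ln (norm z)" using lo x by (intro ln_mono) auto
  have "ln (norm z) - ln x \<le> (norm z - x) / x"
    by (rule ln_diff_le) (use lo x in auto)
  also have "\<dots> \<le> Y / 1" using hi x \<open>Y \<ge> 0\<close> by (intro frac_le) auto
  finally have l2: "ln (norm z) - ln x \<le> Y" by simp
  have m1: "0 \<le> (x + 1) * (ln (x + 1) - ln x)" using x by simp
  have "ln (x + 1) - ln x \<le> (x + 1 - x) / x" by (rule ln_diff_le) (use x in auto)
  hence "(x + 1) * (ln (x + 1) - ln x) \<le> (x + 1) * (1 / x)"
    by (intro mult_left_mono) (use x in auto)
  also have "\<dots> \<le> 2" using x by (simp add: field_simps)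
  finally have m2: "(x + 1) * (ln (x + 1) - ln x) \<le> 2" .
  \<comment> \<open>Grouped like this, the change per unit step is a difference of two bounded
    terms, one in [0, Y] and one in [0, 2], although the single summands grow at least like ln
    x.\<close>
  have "(ln (norm (Gamma (z + 1))) - Re (z + 1) * ln (Re (z + 1))) -
          (ln (norm (Gamma z)) - Re z * ln (Re z)) =
        (ln (norm z) - ln x) - (x + 1) * (ln (x + 1) - ln x)"
    unfolding G by (simp add: x_def algebra_simps)
  thus ?thesis using l1 l2 m1 m2 \<open>Y \<ge> 0\<close> by linarith
qed

text \<open>Unit steps to the left lead from z to the rectangle 1 \<le> Re z \<le> 2, where
  compactness bounds the deviation from x ln x. At most Re z steps of cost Y + 2 add up to a linear
  error, which absorbs the base constant too because Re z \<ge> 1.\<close>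

lemma ln_norm_Gamma_strip:
  fixes Y :: real
  shows "\<exists>C\<ge>0. \<forall>z. 1 \<le> Re z \<and> \<bar>Im z\<bar> \<le> Y \<longrightarrow>
           \<bar>ln (norm (Gamma z)) - Re z * ln (Re z)\<bar> \<le> C * Re z"
proof (cases "Y \<ge> 0")
  case False
  thus ?thesis by (intro exI[of _ 0]) auto
next
  case Y: True
  define D where "D = (\<lambda>z::complex. ln (norm (Gamma z)) - Re z * ln (Re z))"
  define S where "S = cbox (Complex 1 (- Y)) (Complex 2 Y)"
  have S: "z \<in> S \<longleftrightarrow> 1 \<le> Re z \<and> Re z \<le> 2 \<and> \<bar>Im z\<bar> \<le> Y" for z
    by (auto simp: S_def in_cbox_complex_iff)
  have npos: "z \<notin> \<int>\<^sub>\<le>\<^sub>0" if "1 \<le> Re z" for z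
    using that by (auto elim!: nonpos_Ints_cases)
  have "continuous_on S D"
    unfolding D_def using npos
    by (intro continuous_intros) (auto simp: S Gamma_eq_zero_iff)
  hence "bounded (D ` S)"
    by (intro compact_imp_bounded compact_continuous_image) (simp_all add: S_def compact_cbox)
  then obtain B where B: "\<And>z. z \<in> S \<Longrightarrow> \<bar>D z\<bar> \<le> B"
    by (auto simp: bounded_iff)
  have "Complex 1 0 \<in> S" using Y by (simp add: S)
  hence B0: "B \<ge> 0" using B by fastforce
  have *: "\<bar>D z\<bar> \<le> B + (Y + 2) * real k"
    if "1 \<le> Re z" "Re z \<le> real k + 2" "\<bar>Im z\<bar> \<le> Y" for z k
    using that
  proof (induction k arbitrary: z)
    case 0
    thus ?case using B[of z] by (simp add: S)
  next
    case (Suc k)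
    show ?case
    proof (cases "Re z \<le> 2")
      case True
      hence "\<bar>D z\<bar> \<le> B" using B[of z] Suc by (simp add: S)
      also have "\<dots> \<le> B + (Y + 2) * real (Suc k)" using Y by simp
      finally show ?thesis .
    next
      case False
      have "\<bar>D (z - 1)\<bar> \<le> B + (Y + 2) * real k"
        by (rule Suc.IH) (use Suc.prems False in auto)
      moreover have "\<bar>D (z - 1 + 1) - D (z - 1)\<bar> \<le> Y + 2"
        unfolding D_def
        by (rule ln_norm_Gamma_plus1_deviation) (use Suc.prems False in auto)
      ultimately show ?thesis by (simp add: algebra_simps)
    qed
  qed
  show ?thesis
  proof (intro exI[of _ "B + (Y + 2)"] conjI allI impI)
    show "0 \<le> B + (Y + 2)" using B0 Y by simp
    fix z :: complex assume z: "1 \<le> Re z \<and> \<bar>Im z\<bar> \<le> Y"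
    define k where "k = nat \<lfloor>Re z - 1\<rfloor>"
    have k: "real k \<le> Re z" "Re z \<le> real k + 2" unfolding k_def using z by linarith+
    have "\<bar>D z\<bar> \<le> B + (Y + 2) * real k" by (rule *) (use z k in auto)
    also have "\<dots> \<le> B * Re z + (Y + 2) * Re z"
      using z k B0 Y by (intro add_mono mult_left_mono) (auto simp: mult_le_cancel_left1)
    finally show "\<bar>ln (norm (Gamma z)) - Re z * ln (Re z)\<bar> \<le> (B + (Y + 2)) * Re z"
      by (simp add: D_def algebra_simps)
  qed
qed

section \<open>A growth scale on horizontal strips that is additive under products\<close>

text \<open>\<open>d\<close> is the coefficient of x ln x; the linear term is hidden behind the
  quantifier, so nothing but \<open>d\<close> has to be tracked. \<open>S\<close> is a set of
  ordinates because sometimes only two lines and sometimes a whole strip is under control.\<close>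

definition strip_growth :: "real set \<Rightarrow> (complex \<Rightarrow> complex) \<Rightarrow> real \<Rightarrow> bool" where
  "strip_growth S f d \<longleftrightarrow>
     (\<exists>C. \<forall>\<^sub>F x in at_top. \<forall>y\<in>S. norm (f (Complex x y)) \<le> exp (d * (x * ln x) + C * x))"

lemma strip_growth_mult:
  assumes "strip_growth S f d" "strip_growth S g e"
  shows "strip_growth S (\<lambda>s. f s * g s) (d + e)"
proof -
  obtain C D where
    "\<forall>\<^sub>F x in at_top. \<forall>y\<in>S. norm (f (Complex x y)) \<le> exp (d * (x * ln x) + C * x)"
    "\<forall>\<^sub>F x in at_top. \<forall>y\<in>S. norm (g (Complex x y)) \<le> exp (e * (x * ln x) + D * x)"
    using assms by (auto simp: strip_growth_def)
  hence "\<forall>\<^sub>F x in at_top. \<forall>y\<in>S. norm (f (Complex x y) * g (Complex x y)) \<le>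
           exp ((d + e) * (x * ln x) + (C + D) * x)"
  proof eventually_elim
    case (elim x)
    show ?case
    proof
      fix y assume "y \<in> S"
      hence "norm (f (Complex x y) * g (Complex x y)) \<le>
               exp (d * (x * ln x) + C * x) * exp (e * (x * ln x) + D * x)"
        unfolding norm_mult using elim by (intro mult_mono) auto
      thus "norm (f (Complex x y) * g (Complex x y)) \<le>
              exp ((d + e) * (x * ln x) + (C + D) * x)"
        by (simp add: exp_add[symmetric] algebra_simps)
    qed
  qed
  thus ?thesis unfolding strip_growth_def by blast
qed

lemma strip_growth_bounded:
  assumes "\<forall>\<^sub>F x in at_top. \<forall>y\<in>S. norm (f (Complex x y)) \<le> B"
  shows "strip_growth S f 0"
proof -
  have "\<forall>\<^sub>F x in at_top. \<forall>y\<in>S. norm (f (Complex x y)) \<le> exp (0 * (x * ln x) + B * x)"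
    using assms eventually_ge_at_top[of 1]
  proof eventually_elim
    case (elim x)
    show ?case
    proof
      fix y assume "y \<in> S"
      hence *: "norm (f (Complex x y)) \<le> B" using elim by blast
      hence "0 \<le> B" using norm_ge_zero order_trans by blast
      have "B \<le> B * x" using \<open>0 \<le> B\<close> elim by (simp add: mult_le_cancel_left1)
      also have "\<dots> \<le> exp (B * x)" using exp_ge_add_one_self[of "B * x"] by linarith
      finally show "norm (f (Complex x y)) \<le> exp (0 * (x * ln x) + B * x)" using * by simp
    qed
  qed
  thus ?thesis unfolding strip_growth_def by blast
qed

lemma strip_growth_prod:
  assumes "\<And>i. i \<in> I \<Longrightarrow> strip_growth S (f i) (d i)"
  shows "strip_growth S (\<lambda>s. \<Prod>i\<in>I. f i s) (\<Sum>i\<in>I. d i)"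
  using assms
proof (induction I rule: infinite_finite_induct)
  case (insert i I)
  thus ?case using strip_growth_mult[of S "f i" "d i" "\<lambda>s. \<Prod>i\<in>I. f i s"] by simp
qed (auto intro!: strip_growth_bounded[where B = 1])

lemma strip_growth_cong:
  assumes "\<forall>\<^sub>F x in at_top. \<forall>y\<in>S. f (Complex x y) = g (Complex x y)" "strip_growth S g d"
  shows "strip_growth S f d"
proof -
  obtain C where "\<forall>\<^sub>F x in at_top. \<forall>y\<in>S. norm (g (Complex x y)) \<le> exp (d * (x * ln x) + C * x)"
    using assms(2) by (auto simp: strip_growth_def)
  with assms(1)
  have "\<forall>\<^sub>F x in at_top. \<forall>y\<in>S. norm (f (Complex x y)) \<le> exp (d * (x * ln x) + C * x)"
    by eventually_elim auto
  thus ?thesis unfolding strip_growth_def by blast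
qed

text \<open>With d < 0 the term d x ln x eventually falls below -(C + 1) x for whatever C is hidden
  in the growth bound. The rate exp (- x) is a convenient integrable choice.\<close>

lemma strip_growth_negative:
  assumes "strip_growth S f d" "d < 0"
  shows "\<forall>\<^sub>F x in at_top. \<forall>y\<in>S. norm (f (Complex x y)) \<le> exp (- x)"
proof -
  obtain C where C: "\<forall>\<^sub>F x in at_top. \<forall>y\<in>S. norm (f (Complex x y)) \<le> exp (d * (x * ln x) + C * x)"
    using assms by (auto simp: strip_growth_def)
  have "\<forall>\<^sub>F x::real in at_top. d * (x * ln x) + C * x \<le> - x"
    using \<open>d < 0\<close> by real_asymp
  with C show ?thesis
    by eventually_elim (auto intro: order_trans)
qed

text \<open>Replacing x by Re b + \<beta> x changes \<beta> x ln x to leading order by \<beta> ln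
  \<beta> x, hence only by O(x). The estimate is two-sided because \<open>Gamma\<close> uses its
  upper and \<open>rGamma\<close> its lower half.\<close>

lemma ln_norm_Gamma_affine:
  fixes b :: complex and \<beta> :: real
  assumes "\<beta> > 0" "bounded S"
  shows "\<exists>C. \<forall>\<^sub>F x in at_top. \<forall>y\<in>S. b + of_real \<beta> * Complex x y \<notin> \<int>\<^sub>\<le>\<^sub>0 \<and>
           \<bar>ln (norm (Gamma (b + of_real \<beta> * Complex x y))) - \<beta> * (x * ln x)\<bar> \<le> C * x"
proof -
  obtain M where M: "\<And>y. y \<in> S \<Longrightarrow> \<bar>y\<bar> \<le> M"
    using assms(2) by (auto simp: bounded_iff)
  define r where "r = Re b"
  obtain C where C: "C \<ge> 0" "\<And>z. 1 \<le> Re z \<Longrightarrow> \<bar>Im z\<bar> \<le> \<bar>Im b\<bar> + \<beta> * M \<Longrightarrow>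
      \<bar>ln (norm (Gamma z)) - Re z * ln (Re z)\<bar> \<le> C * Re z"
    using ln_norm_Gamma_strip[of "\<bar>Im b\<bar> + \<beta> * M"] by blast
  have "(\<lambda>x::real. (r + \<beta> * x) * ln (r + \<beta> * x) - \<beta> * (x * ln x)) \<in> O(\<lambda>x. x)"
    using \<open>\<beta> > 0\<close> by real_asymp
  then obtain c where c: "\<forall>\<^sub>F x in at_top.
      norm ((r + \<beta> * x) * ln (r + \<beta> * x) - \<beta> * (x * ln x)) \<le> c * norm x"
    unfolding bigo_def by blast
  have "\<forall>\<^sub>F x::real in at_top. r + \<beta> * x \<le> (\<beta> + 1) * x" by real_asymp
  moreover have "\<forall>\<^sub>F x::real in at_top. 1 \<le> r + \<beta> * x" using \<open>\<beta> > 0\<close> by real_asymp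
  ultimately have "\<forall>\<^sub>F x in at_top. \<forall>y\<in>S. b + of_real \<beta> * Complex x y \<notin> \<int>\<^sub>\<le>\<^sub>0 \<and>
           \<bar>ln (norm (Gamma (b + of_real \<beta> * Complex x y))) - \<beta> * (x * ln x)\<bar>
             \<le> (c + C * (\<beta> + 1)) * x"
    using c eventually_gt_at_top[of 0]
  proof eventually_elim
    case (elim x)
    show ?case
    proof
      fix y assume "y \<in> S"
      define z where "z = b + of_real \<beta> * Complex x y"
      have Re: "Re z = r + \<beta> * x" and Im: "Im z = Im b + \<beta> * y" by (simp_all add: z_def r_def)
      have "z \<notin> \<int>\<^sub>\<le>\<^sub>0" using elim Re by (auto elim!: nonpos_Ints_cases)
      moreover have "\<bar>Im b + \<beta> * y\<bar> \<le> \<bar>Im b\<bar> + \<beta> * M"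
        using order_trans[OF abs_triangle_ineq[of "Im b" "\<beta> * y"] add_left_mono]
          mult_left_mono[OF M[OF \<open>y \<in> S\<close>] less_imp_le[OF \<open>\<beta> > 0\<close>]] \<open>\<beta> > 0\<close>
        by (metis abs_mult abs_of_pos)
      hence "\<bar>ln (norm (Gamma z)) - Re z * ln (Re z)\<bar> \<le> C * Re z"
        by (intro C(2)) (use elim Re Im in auto)
      moreover have "C * Re z \<le> C * ((\<beta> + 1) * x)"
        unfolding Re using C(1) elim by (intro mult_left_mono) auto
      ultimately show "z \<notin> \<int>\<^sub>\<le>\<^sub>0 \<and> \<bar>ln (norm (Gamma z)) - \<beta> * (x * ln x)\<bar> \<le> (c + C * (\<beta> + 1)) * x"
        using elim unfolding Re by (simp add: algebra_simps)
    qed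
  qed
  thus ?thesis by blast
qed

lemma strip_growth_Gamma:
  assumes "\<beta> > 0" "bounded S"
  shows "strip_growth S (\<lambda>s. Gamma (b + of_real \<beta> * s)) \<beta>"
proof -
  obtain C where C: "\<forall>\<^sub>F x in at_top. \<forall>y\<in>S. b + of_real \<beta> * Complex x y \<notin> \<int>\<^sub>\<le>\<^sub>0 \<and>
     \<bar>ln (norm (Gamma (b + of_real \<beta> * Complex x y))) - \<beta> * (x * ln x)\<bar> \<le> C * x"
    using ln_norm_Gamma_affine[OF assms] by blast
  hence "\<forall>\<^sub>F x in at_top. \<forall>y\<in>S. norm (Gamma (b + of_real \<beta> * Complex x y)) \<le>
           exp (\<beta> * (x * ln x) + C * x)"
  proof eventually_elim
    case (elim x)
    show ?case
    proof
      fix y assume "y \<in> S"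
      let ?g = "norm (Gamma (b + of_real \<beta> * Complex x y))"
      have "?g > 0" using elim \<open>y \<in> S\<close> by (simp add: Gamma_eq_zero_iff)
      moreover have "ln ?g \<le> \<beta> * (x * ln x) + C * x" using elim \<open>y \<in> S\<close> by fastforce
      ultimately show "?g \<le> exp (\<beta> * (x * ln x) + C * x)"
        by (metis exp_le_cancel_iff exp_ln)
    qed
  qed
  thus ?thesis unfolding strip_growth_def by blast
qed

lemma strip_growth_rGamma:
  assumes "\<beta> > 0" "bounded S"
  shows "strip_growth S (\<lambda>s. rGamma (b + of_real \<beta> * s)) (- \<beta>)"
proof -
  obtain C where C: "\<forall>\<^sub>F x in at_top. \<forall>y\<in>S. b + of_real \<beta> * Complex x y \<notin> \<int>\<^sub>\<le>\<^sub>0 \<and>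
     \<bar>ln (norm (Gamma (b + of_real \<beta> * Complex x y))) - \<beta> * (x * ln x)\<bar> \<le> C * x"
    using ln_norm_Gamma_affine[OF assms] by blast
  hence "\<forall>\<^sub>F x in at_top. \<forall>y\<in>S. norm (rGamma (b + of_real \<beta> * Complex x y)) \<le>
           exp (- \<beta> * (x * ln x) + C * x)"
  proof eventually_elim
    case (elim x)
    show ?case
    proof
      fix y assume "y \<in> S"
      let ?g = "norm (Gamma (b + of_real \<beta> * Complex x y))"
      have "?g > 0" using elim \<open>y \<in> S\<close> by (simp add: Gamma_eq_zero_iff)
      moreover have "\<beta> * (x * ln x) - C * x \<le> ln ?g" using elim \<open>y \<in> S\<close> by fastforce
      ultimately have "exp (\<beta> * (x * ln x) - C * x) \<le> ?g" by (simp add: ln_ge_iff)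
      hence "inverse ?g \<le> inverse (exp (\<beta> * (x * ln x) - C * x))"
        by (rule le_imp_inverse_le) simp
      thus "norm (rGamma (b + of_real \<beta> * Complex x y)) \<le> exp (- \<beta> * (x * ln x) + C * x)"
        by (simp add: rGamma_inverse_Gamma norm_inverse exp_minus[symmetric])
    qed
  qed
  thus ?thesis unfolding strip_growth_def by blast
qed

section \<open>Reflected factors, controlled through the sine\<close>

lemma norm_sin_le_exp: "norm (sin z) \<le> exp \<bar>Im z\<bar>" for z :: complex
proof -
  have "norm (exp (\<i> * z) - exp (- (\<i> * z))) \<le> norm (exp (\<i> * z)) + norm (exp (- (\<i> * z)))"
    by (rule norm_triangle_ineq4)
  also have "\<dots> \<le> exp \<bar>Im z\<bar> + exp \<bar>Im z\<bar>" by (intro add_mono) auto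
  finally show ?thesis by (simp add: sin_exp_eq norm_divide norm_mult)
qed

text \<open>From |sin z|^2 = sinh(Im z)^2 + sin(Re z)^2. The bound is uniform in Re z, which is what
  a horizontal line off the real axis needs.\<close>

lemma norm_sin_ge_sinh: "norm (sin z) \<ge> \<bar>sinh (Im z)\<bar>" for z :: complex
proof -
  have "(sinh (Im z))\<^sup>2 = (exp (2 * Im z) + inverse (exp (2 * Im z)) - 2) / 4"
    by (simp add: sinh_field_def power2_eq_square algebra_simps exp_minus[symmetric]
          flip: exp_add)
  also have "\<dots> \<le> (norm (sin z))\<^sup>2"
    unfolding norm_sin_squared by (intro divide_right_mono) auto
  finally show ?thesis using abs_le_square_iff[of "sinh (Im z)" "norm (sin z)"] by simp
qed

text \<open>The identity 1 / Gamma(1 - w) = sin(pi w) / pi * Gamma(w) turns an argument that runs to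
  the left into one that runs to the right. Zeros of the sine in the numerator do no harm, so
  boundedness of the ordinates suffices.\<close>

lemma strip_growth_rGamma_reflected:
  assumes "\<beta> > 0" "bounded S"
  shows "strip_growth S (\<lambda>s. rGamma (1 - b - of_real \<beta> * s)) \<beta>"
proof -
  obtain M where M: "\<And>y. y \<in> S \<Longrightarrow> \<bar>y\<bar> \<le> M"
    using assms(2) by (auto simp: bounded_iff)
  let ?s = "\<lambda>s. sin (of_real pi * (b + of_real \<beta> * s)) / of_real pi"
  have "strip_growth S ?s 0"
  proof (rule strip_growth_bounded[where B = "exp (pi * (\<bar>Im b\<bar> + \<beta> * M)) / pi"], rule always_eventually, safe)
    fix x y assume "y \<in> S"
    have "norm (?s (Complex x y)) \<le> exp (pi * \<bar>Im b + \<beta> * y\<bar>) / pi"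
      using norm_sin_le_exp[of "of_real pi * (b + of_real \<beta> * Complex x y)"]
      by (auto simp: norm_divide abs_mult intro!: divide_right_mono)
    also have "\<bar>Im b + \<beta> * y\<bar> \<le> \<bar>Im b\<bar> + \<beta> * M"
      using order_trans[OF abs_triangle_ineq[of "Im b" "\<beta> * y"] add_left_mono]
        mult_left_mono[OF M[OF \<open>y \<in> S\<close>] less_imp_le[OF \<open>\<beta> > 0\<close>]] \<open>\<beta> > 0\<close>
      by (metis abs_mult abs_of_pos)
    finally show "norm (?s (Complex x y)) \<le> exp (pi * (\<bar>Im b\<bar> + \<beta> * M)) / pi"
      by (simp add: divide_right_mono)
  qed
  from strip_growth_mult[OF this strip_growth_Gamma[OF assms, of b]]
  have "strip_growth S (\<lambda>s. ?s s * Gamma (b + of_real \<beta> * s)) \<beta>" by simp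
  moreover obtain C where "\<forall>\<^sub>F x in at_top. \<forall>y\<in>S. b + of_real \<beta> * Complex x y \<notin> \<int>\<^sub>\<le>\<^sub>0 \<and>
     \<bar>ln (norm (Gamma (b + of_real \<beta> * Complex x y))) - \<beta> * (x * ln x)\<bar> \<le> C * x"
    using ln_norm_Gamma_affine[OF assms] by blast
  hence "\<forall>\<^sub>F x in at_top. \<forall>y\<in>S. rGamma (1 - b - of_real \<beta> * Complex x y) =
           ?s (Complex x y) * Gamma (b + of_real \<beta> * Complex x y)"
  proof eventually_elim
    case (elim x)
    show ?case
    proof
      fix y assume "y \<in> S"
      define z where "z = b + of_real \<beta> * Complex x y"
      have "Gamma z \<noteq> 0" using elim \<open>y \<in> S\<close> by (simp add: Gamma_eq_zero_iff z_def)
      have "sin (of_real pi * z) / of_real pi * Gamma z = rGamma (1 - z) * (rGamma z * Gamma z)"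
        by (simp add: rGamma_reflection_complex[symmetric])
      also have "rGamma z * Gamma z = 1" using \<open>Gamma z \<noteq> 0\<close> by (simp add: rGamma_inverse_Gamma)
      finally show "rGamma (1 - b - of_real \<beta> * Complex x y) =
           ?s (Complex x y) * Gamma (b + of_real \<beta> * Complex x y)"
        by (simp add: z_def algebra_simps)
    qed
  qed
  ultimately show ?thesis by (rule strip_growth_cong[rotated])
qed

text \<open>Now the sine sits in the denominator: the ordinates have to keep w off the real axis,
  and compactness of \<open>S\<close> turns this into a uniform lower bound for |sin(pi w)|.\<close>

lemma strip_growth_Gamma_reflected:
  assumes "\<alpha> > 0" "compact S" "\<And>y. y \<in> S \<Longrightarrow> Im a + \<alpha> * y \<noteq> 0"
  shows "strip_growth S (\<lambda>s. Gamma (1 - a - of_real \<alpha> * s)) (- \<alpha>)"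
proof -
  have bS: "bounded S" using assms compact_imp_bounded by blast
  let ?s = "\<lambda>s. of_real pi / sin (of_real pi * (a + of_real \<alpha> * s))"
  have "continuous_on S (\<lambda>y. inverse \<bar>sinh (pi * (Im a + \<alpha> * y))\<bar>)"
    by (intro continuous_intros) (use assms(3) in auto)
  hence "bounded ((\<lambda>y. inverse \<bar>sinh (pi * (Im a + \<alpha> * y))\<bar>) ` S)"
    using assms(2) by (intro compact_imp_bounded compact_continuous_image)
  then obtain B where B: "\<And>y. y \<in> S \<Longrightarrow> inverse \<bar>sinh (pi * (Im a + \<alpha> * y))\<bar> \<le> B"
    unfolding bounded_iff by fastforce
  have "strip_growth S ?s 0"
  proof (rule strip_growth_bounded[where B = "pi * B"], rule always_eventually, safe)
    fix x y assume "y \<in> S"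
    define z where "z = of_real pi * (a + of_real \<alpha> * Complex x y)"
    have Im: "Im z = pi * (Im a + \<alpha> * y)" by (simp add: z_def)
    have pos: "\<bar>sinh (Im z)\<bar> > 0" using assms(3)[OF \<open>y \<in> S\<close>] by (simp add: Im)
    have "1 / norm (sin z) \<le> 1 / \<bar>sinh (Im z)\<bar>"
      using norm_sin_ge_sinh[of z] pos by (intro frac_le) auto
    also have "\<dots> \<le> B" using B[OF \<open>y \<in> S\<close>] by (simp add: Im divide_inverse)
    finally show "norm (of_real pi / sin z) \<le> pi * B"
      using mult_left_mono[of "1 / norm (sin z)" B pi] by (simp add: norm_divide)
  qed
  from strip_growth_mult[OF this strip_growth_rGamma[OF assms(1) bS, of a]]
  have "strip_growth S (\<lambda>s. ?s s * rGamma (a + of_real \<alpha> * s)) (- \<alpha>)" by simp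
  moreover obtain C where "\<forall>\<^sub>F x in at_top. \<forall>y\<in>S. a + of_real \<alpha> * Complex x y \<notin> \<int>\<^sub>\<le>\<^sub>0 \<and>
     \<bar>ln (norm (Gamma (a + of_real \<alpha> * Complex x y))) - \<alpha> * (x * ln x)\<bar> \<le> C * x"
    using ln_norm_Gamma_affine[OF assms(1) bS] by blast
  hence "\<forall>\<^sub>F x in at_top. \<forall>y\<in>S. Gamma (1 - a - of_real \<alpha> * Complex x y) =
           ?s (Complex x y) * rGamma (a + of_real \<alpha> * Complex x y)"
  proof eventually_elim
    case (elim x)
    show ?case
    proof
      fix y assume "y \<in> S"
      define z where "z = a + of_real \<alpha> * Complex x y"
      have "Gamma z \<noteq> 0" using elim \<open>y \<in> S\<close> by (simp add: Gamma_eq_zero_iff z_def)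
      have "of_real pi / sin (of_real pi * z) * rGamma z = Gamma (1 - z) * (rGamma z * Gamma z)"
        by (simp add: Gamma_reflection_complex[symmetric])
      also have "rGamma z * Gamma z = 1" using \<open>Gamma z \<noteq> 0\<close> by (simp add: rGamma_inverse_Gamma)
      finally show "Gamma (1 - a - of_real \<alpha> * Complex x y) =
           ?s (Complex x y) * rGamma (a + of_real \<alpha> * Complex x y)"
        by (simp add: z_def algebra_simps)
    qed
  qed
  ultimately show ?thesis by (rule strip_growth_cong[rotated])
qed

text \<open>After reflection each \<alpha>_i contributes -\<alpha>_i and each \<beta>_j contributes
  \<beta>_j, on whichever side of the fraction bar its factor stands. The sum is Delta for all m and
  n.\<close>

lemma strip_growth_fox_kernel:
  assumes "m \<le> q" "n \<le> p" "\<forall>i\<in>{1..p}. \<alpha> i > 0" "\<forall>j\<in>{1..q}. \<beta> j > 0"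
    and "compact S" "\<And>i y. i \<in> {1..n} \<Longrightarrow> y \<in> S \<Longrightarrow> Im (a i) + \<alpha> i * y \<noteq> 0"
  shows "strip_growth S (fox_kernel m n p q a \<alpha> b \<beta>) (fox_Delta p q \<alpha> \<beta>)"
proof -
  have bS: "bounded S" using assms compact_imp_bounded by blast
  have split: "(\<Sum>i=1..l. f i) = (\<Sum>i=1..k. f i) + (\<Sum>i=k+1..l. f i)" if "k \<le> l"
    for k l and f :: "nat \<Rightarrow> real"
    using sum.ub_add_nat[of 1 k f "l - k"] that by simp
  have "strip_growth S (\<lambda>s.
     (\<Prod>j=1..m. Gamma (b j + of_real (\<beta> j) * s)) *
     (\<Prod>i=1..n. Gamma (1 - a i - of_real (\<alpha> i) * s)) *
     (\<Prod>i=n+1..p. rGamma (a i + of_real (\<alpha> i) * s)) *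
     (\<Prod>j=m+1..q. rGamma (1 - b j - of_real (\<beta> j) * s)))
     ((\<Sum>j=1..m. \<beta> j) + (\<Sum>i=1..n. - \<alpha> i) + (\<Sum>i=n+1..p. - \<alpha> i) + (\<Sum>j=m+1..q. \<beta> j))"
    by (intro strip_growth_mult strip_growth_prod strip_growth_Gamma strip_growth_rGamma
          strip_growth_rGamma_reflected strip_growth_Gamma_reflected bS assms(5,6))
       (use assms(1-4) in auto)
  also have "(\<Sum>j=1..m. \<beta> j) + (\<Sum>i=1..n. - \<alpha> i) + (\<Sum>i=n+1..p. - \<alpha> i) + (\<Sum>j=m+1..q. \<beta> j)
               = fox_Delta p q \<alpha> \<beta>"
    unfolding fox_Delta_def split[OF assms(1)] split[OF assms(2)] by (simp add: sum_negf)
  finally show ?thesis unfolding fox_kernel_def .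
qed

section \<open>Winding numbers of the truncated loop\<close>

lemma closed_segment_horizontal:
  "x \<le> x' \<Longrightarrow> closed_segment (Complex x y) (Complex x' y) = {s. Im s = y \<and> x \<le> Re s \<and> Re s \<le> x'}"
  "x \<le> x' \<Longrightarrow> closed_segment (Complex x' y) (Complex x y) = {s. Im s = y \<and> x \<le> Re s \<and> Re s \<le> x'}"
  by (auto simp: closed_segment_same_Im closed_segment_eq_real_ivl)

lemma closed_segment_vertical:
  "y \<le> y' \<Longrightarrow> closed_segment (Complex x y') (Complex x y) = {s. Re s = x \<and> y \<le> Im s \<and> Im s \<le> y'}"
  by (auto simp: closed_segment_same_Re closed_segment_eq_real_ivl)

text \<open>The edges carry the directions in which the loops run through them, horizontal ones
  rightwards and vertical ones downwards; hence the two minus signs.\<close>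

lemma contour_integral_rectpath:
  assumes "continuous_on (path_image (rectpath (Complex x y) (Complex x' y'))) f" "x \<le> x'" "y \<le> y'"
  shows "contour_integral (rectpath (Complex x y) (Complex x' y')) f =
    contour_integral (linepath (Complex x y) (Complex x' y)) f
    - contour_integral (linepath (Complex x' y') (Complex x' y)) f
    - contour_integral (linepath (Complex x y') (Complex x' y')) f
    + contour_integral (linepath (Complex x y') (Complex x y)) f"
proof -
  let ?a = "Complex x y" and ?b = "Complex x' y" and ?c = "Complex x' y'" and ?d = "Complex x y'"
  have "path_image (rectpath ?a ?c) =
      closed_segment ?a ?b \<union> closed_segment ?b ?c \<union> closed_segment ?c ?d \<union> closed_segment ?d ?a"
    by (simp add: rectpath_def Let_def path_image_join Un_assoc)
  hence *: "continuous_on (closed_segment ?a ?b) f" "continuous_on (closed_segment ?b ?c) f"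
    "continuous_on (closed_segment ?c ?d) f" "continuous_on (closed_segment ?d ?a) f"
    using assms(1) by (auto elim: continuous_on_subset)
  have "contour_integral (linepath ?b ?c) f = - contour_integral (linepath ?c ?b) f"
    "contour_integral (linepath ?c ?d) f = - contour_integral (linepath ?d ?c) f"
    using contour_integral_reverse_linepath * by blast+
  thus ?thesis using *
    by (simp add: rectpath_def Let_def contour_integrable_continuous_linepath valid_path_join)
qed

section \<open>The loop cut off at Re s = T and closed by a vertical edge\<close>

locale unbounded_loop =
  fixes \<phi>1 \<phi>2 R :: real and \<gamma> :: "real \<Rightarrow> complex"
  assumes loop: "infinite_loop \<phi>1 \<phi>2 R \<gamma>"
begin

definition loop_image :: "complex set" where
  "loop_image = {s. Im s = \<phi>1 \<and> R \<le> Re s} \<union> path_image \<gamma> \<union> {s. Im s = \<phi>2 \<and> R \<le> Re s}"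

text \<open>With \<gamma> strictly to the left of the cut, the closing edge meets the truncated loop
  in its two end points only.\<close>

definition beyond :: "real \<Rightarrow> bool" where
  "beyond T \<longleftrightarrow> R < T \<and> (\<forall>s\<in>path_image \<gamma>. Re s < T)"

abbreviation truncated :: "real \<Rightarrow> real \<Rightarrow> complex" where
  "truncated T \<equiv> loop_upto \<phi>1 \<phi>2 R \<gamma> T"

abbreviation closed_up :: "real \<Rightarrow> real \<Rightarrow> complex" where
  "closed_up T \<equiv> closed_loop_upto \<phi>1 \<phi>2 R \<gamma> T"

abbreviation edge :: "real \<Rightarrow> real \<Rightarrow> complex" where
  "edge T \<equiv> linepath (Complex T \<phi>2) (Complex T \<phi>1)"

lemma loopD:
  "\<phi>1 < \<phi>2" "valid_path \<gamma>" "arc \<gamma>" "pathstart \<gamma> = Complex R \<phi>1" "pathfinish \<gamma> = Complex R \<phi>2"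
  "path_image \<gamma> \<inter> {s. Im s = \<phi>1 \<and> R \<le> Re s} = {Complex R \<phi>1}"
  "path_image \<gamma> \<inter> {s. Im s = \<phi>2 \<and> R \<le> Re s} = {Complex R \<phi>2}"
  using loop by (auto simp: infinite_loop_def)

lemma eventually_beyond: "\<forall>\<^sub>F T in at_top. beyond T"
proof -
  have "bounded (path_image \<gamma>)" using loopD(2) by (simp add: bounded_path_image valid_path_imp_path)
  then obtain B where "\<And>s. s \<in> path_image \<gamma> \<Longrightarrow> norm s \<le> B" by (auto simp: bounded_iff)
  hence "beyond T" if "T > max R B" for T
    using that unfolding beyond_def by (fastforce intro: le_less_trans[OF complex_Re_le_cmod])
  thus ?thesis by (intro eventually_mono[OF eventually_gt_at_top[of "max R B"]])
qed

lemma beyond_mono: "beyond T \<Longrightarrow> T \<le> T' \<Longrightarrow> beyond T'"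
  by (fastforce simp: beyond_def)

lemma path_image_truncated:
  "R \<le> T \<Longrightarrow> path_image (truncated T) =
     {s. Im s = \<phi>1 \<and> R \<le> Re s \<and> Re s \<le> T} \<union> path_image \<gamma> \<union> {s. Im s = \<phi>2 \<and> R \<le> Re s \<and> Re s \<le> T}"
  using loopD by (simp add: loop_upto_def path_image_join closed_segment_horizontal Un_assoc)

lemma path_image_edge: "path_image (edge T) = {s. Re s = T \<and> \<phi>1 \<le> Im s \<and> Im s \<le> \<phi>2}"
  using loopD by (simp add: closed_segment_vertical)

lemma path_image_closed_up:
  "path_image (closed_up T) = path_image (truncated T) \<union> path_image (edge T)"
  using loopD by (simp add: closed_loop_upto_def path_image_join loop_upto_def)

lemma truncated_subset: "R \<le> T \<Longrightarrow> path_image (truncated T) \<subseteq> loop_image"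
  by (auto simp: path_image_truncated loop_image_def)

lemma valid_path_closed_up: "valid_path (closed_up T)"
  using loopD by (simp add: closed_loop_upto_def loop_upto_def valid_path_join)

lemma closed_up_ends [simp]:
  "pathstart (closed_up T) = Complex T \<phi>1" "pathfinish (closed_up T) = Complex T \<phi>1"
  by (simp_all add: closed_loop_upto_def loop_upto_def)

text \<open>Simplicity is what gives one common winding number, 1 or -1, at all inside points. The
  two intersection conditions in \<open>infinite_loop\<close> are what keeps the joins of \<gamma>
  with the half-lines free of double points.\<close>

lemma simple_path_closed_up:
  assumes "beyond T"
  shows "simple_path (closed_up T)"
proof -
  have T: "R < T" "\<And>s. s \<in> path_image \<gamma> \<Longrightarrow> Re s < T" using assms by (auto simp: beyond_def)
  note [simp] = loopD(4,5)
  have lines: "s = Complex R \<phi>1" if "s \<in> path_image \<gamma>" "Im s = \<phi>1" "R \<le> Re s" for s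
    using loopD(6) that by blast
  have lines2: "s = Complex R \<phi>2" if "s \<in> path_image \<gamma>" "Im s = \<phi>2" "R \<le> Re s" for s
    using loopD(7) that by blast
  have arcs: "arc (linepath (Complex T \<phi>1) (Complex R \<phi>1))" "arc (linepath (Complex R \<phi>2) (Complex T \<phi>2))"
    using T by (auto intro!: arc_linepath)
  have "arc (\<gamma> +++ linepath (Complex R \<phi>2) (Complex T \<phi>2))"
    by (rule arc_join[OF loopD(3) arcs(2)]) (use T lines2 in \<open>auto simp: closed_segment_horizontal\<close>)
  hence "arc (truncated T)"
    unfolding loop_upto_def
    by (rule arc_join[OF arcs(1)])
       (use T(1) loopD(1) lines in \<open>auto simp: closed_segment_horizontal path_image_join complex_eq_iff\<close>)
  moreover have "arc (edge T)" using loopD(1) by (intro arc_linepath) auto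
  moreover have "path_image (truncated T) \<inter> path_image (edge T) \<subseteq> {Complex T \<phi>1, Complex T \<phi>2}"
    using T unfolding path_image_edge
    by (auto simp: path_image_truncated complex_eq_iff)
  ultimately show ?thesis
    unfolding closed_loop_upto_def
    by (intro simple_path_join_loop) (auto simp: loop_upto_def)
qed

lemma path_image_rect:
  assumes "T \<le> T'" "R \<le> T"
  shows "path_image (rectpath (Complex T \<phi>1) (Complex T' \<phi>2)) \<subseteq>
     path_image (closed_up T) \<union> path_image (closed_up T')"
  using assms loopD(1)
  by (auto simp: path_image_rectpath path_image_closed_up path_image_truncated path_image_edge
        simp del: path_image_linepath)

text \<open>The cut is moved by splitting the half-lines, not by deforming across the strip: f is
  holomorphic near the loop only and may have poles between the half-lines.\<close>

lemma contour_integral_truncated: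
  assumes "beyond T" "T \<le> T'" "open U" "loop_image \<subseteq> U" "f holomorphic_on U"
  shows "contour_integral (truncated T') f = contour_integral (truncated T) f
      + contour_integral (linepath (Complex T \<phi>2) (Complex T' \<phi>2)) f
      - contour_integral (linepath (Complex T \<phi>1) (Complex T' \<phi>1)) f"
    and "f contour_integrable_on truncated T'"
proof -
  have RT: "R < T" using assms by (simp add: beyond_def)
  have cont: "continuous_on U f" using assms(5) by (rule holomorphic_on_imp_continuous_on)
  have c: "continuous_on (closed_segment (Complex x y) (Complex x' y)) f"
    if "R \<le> x" "R \<le> x'" "y = \<phi>1 \<or> y = \<phi>2" for x x' y
  proof (rule continuous_on_subset[OF cont])
    show "closed_segment (Complex x y) (Complex x' y) \<subseteq> U"
      using that assms(4)
      by (cases "x \<le> x'") (auto simp: closed_segment_horizontal loop_image_def)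
  qed
  have ig: "f contour_integrable_on \<gamma>"
    using assms(3-5) loopD(2)
    by (intro contour_integrable_holomorphic_simple[of f U]) (auto simp: loop_image_def)
  have i: "f contour_integrable_on linepath (Complex x y) (Complex x' y)"
    if "R \<le> x" "R \<le> x'" "y = \<phi>1 \<or> y = \<phi>2" for x x' y
    by (rule contour_integrable_continuous_linepath[OF c]) (use that in auto)
  have e: "contour_integral (truncated t) f =
     contour_integral (linepath (Complex t \<phi>1) (Complex R \<phi>1)) f + contour_integral \<gamma> f +
     contour_integral (linepath (Complex R \<phi>2) (Complex t \<phi>2)) f"
    "f contour_integrable_on truncated t" if "R \<le> t" for t
    using that ig i loopD by (simp_all add: loop_upto_def valid_path_join)
  have "contour_integral (linepath (Complex T' \<phi>1) (Complex R \<phi>1)) f =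
     contour_integral (linepath (Complex T' \<phi>1) (Complex T \<phi>1)) f +
     contour_integral (linepath (Complex T \<phi>1) (Complex R \<phi>1)) f"
    by (rule contour_integral_split_linepath[OF c])
       (use RT assms(2) in \<open>auto simp: closed_segment_horizontal\<close>)
  moreover have "contour_integral (linepath (Complex R \<phi>2) (Complex T' \<phi>2)) f =
     contour_integral (linepath (Complex R \<phi>2) (Complex T \<phi>2)) f +
     contour_integral (linepath (Complex T \<phi>2) (Complex T' \<phi>2)) f"
    by (rule contour_integral_split_linepath[OF c])
       (use RT assms(2) in \<open>auto simp: closed_segment_horizontal\<close>)
  moreover have "contour_integral (linepath (Complex T' \<phi>1) (Complex T \<phi>1)) f =
      - contour_integral (linepath (Complex T \<phi>1) (Complex T' \<phi>1)) f"
    by (rule contour_integral_reverse_linepath[OF c]) (use RT assms(2) in auto)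
  ultimately show "contour_integral (truncated T') f = contour_integral (truncated T) f
      + contour_integral (linepath (Complex T \<phi>2) (Complex T' \<phi>2)) f
      - contour_integral (linepath (Complex T \<phi>1) (Complex T' \<phi>1)) f"
    using RT assms(2) by (simp add: e)
  show "f contour_integrable_on truncated T'" using RT assms(2) by (simp add: e)
qed

lemma contour_integral_closed_up:
  assumes "beyond T" "open U" "loop_image \<subseteq> U" "f holomorphic_on U" "path_image (edge T) \<subseteq> U"
  shows "contour_integral (closed_up T) f = contour_integral (truncated T) f + contour_integral (edge T) f"
proof -
  have "f contour_integrable_on edge T"
    by (intro contour_integrable_continuous_linepath
          continuous_on_subset[OF holomorphic_on_imp_continuous_on[OF assms(4)]])
       (use assms(5) in simp)
  moreover have "f contour_integrable_on truncated T"
    using contour_integral_truncated(2)[OF assms(1) order_refl assms(2-4)] .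
  ultimately show ?thesis
    using loopD unfolding closed_loop_upto_def
    by (intro contour_integral_join) (auto simp: loop_upto_def valid_path_join)
qed

section \<open>Dependence of winding numbers on the cut\<close>

text \<open>The closed loops at T and T' differ by the boundary of the rectangle between the two
  cuts, run clockwise; integrating 1 / (s - w), the common parts cancel.\<close>

lemma winding_number_closed_up_diff:
  assumes "beyond T" "T \<le> T'" "w \<notin> loop_image" "w \<notin> path_image (edge T)" "w \<notin> path_image (edge T')"
  shows "winding_number (closed_up T') w =
     winding_number (closed_up T) w - winding_number (rectpath (Complex T \<phi>1) (Complex T' \<phi>2)) w"
proof -
  define f where "f = (\<lambda>s. 1 / (s - w))"
  have RT: "R < T" using assms by (simp add: beyond_def)
  have hol: "f holomorphic_on - {w}" unfolding f_def by (auto intro!: holomorphic_intros)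
  have cont: "continuous_on (- {w}) f" by (rule holomorphic_on_imp_continuous_on[OF hol])
  have sub: "loop_image \<subseteq> - {w}" using assms by auto
  have b': "beyond T'" using assms beyond_mono by blast
  have ncl: "w \<notin> path_image (closed_up T)" "w \<notin> path_image (closed_up T')"
    using assms RT truncated_subset[of T] truncated_subset[of T'] by (auto simp: path_image_closed_up)
  hence nrect: "w \<notin> path_image (rectpath (Complex T \<phi>1) (Complex T' \<phi>2))"
    using path_image_rect[of T T'] RT assms(2) by auto
  have 1: "contour_integral (closed_up T) f = contour_integral (truncated T) f + contour_integral (edge T) f"
    by (rule contour_integral_closed_up[OF assms(1) _ sub hol]) (use assms in auto)
  have 2: "contour_integral (closed_up T') f = contour_integral (truncated T') f + contour_integral (edge T') f"
    by (rule contour_integral_closed_up[OF b' _ sub hol]) (use assms in auto)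
  have 3: "contour_integral (truncated T') f = contour_integral (truncated T) f
      + contour_integral (linepath (Complex T \<phi>2) (Complex T' \<phi>2)) f
      - contour_integral (linepath (Complex T \<phi>1) (Complex T' \<phi>1)) f"
    by (rule contour_integral_truncated[OF assms(1,2) _ sub hol]) auto
  have 4: "contour_integral (rectpath (Complex T \<phi>1) (Complex T' \<phi>2)) f =
    contour_integral (linepath (Complex T \<phi>1) (Complex T' \<phi>1)) f
    - contour_integral (edge T') f
    - contour_integral (linepath (Complex T \<phi>2) (Complex T' \<phi>2)) f
    + contour_integral (edge T) f"
    by (rule contour_integral_rectpath)
       (use assms(2) loopD(1) nrect in \<open>auto intro: continuous_on_subset[OF cont]\<close>)
  have "contour_integral (closed_up T') f =
     contour_integral (closed_up T) f - contour_integral (rectpath (Complex T \<phi>1) (Complex T' \<phi>2)) f"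
    unfolding 1 2 3 4 by simp
  thus ?thesis
    using ncl nrect
    by (simp add: winding_number_valid_path valid_path_closed_up f_def[symmetric] diff_divide_distrib)
qed

lemma path_image_closed_up_Re:
  assumes "beyond T"
  shows "path_image (closed_up T) \<subseteq> {s. Re s \<le> T}"
  using assms by (auto simp: beyond_def path_image_closed_up path_image_truncated path_image_edge less_imp_le
        simp del: path_image_linepath)

lemma winding_number_closed_up_right:
  assumes "beyond T" "T < Re w"
  shows "winding_number (closed_up T) w = 0"
  by (rule winding_number_zero_outside[OF _ convex_halfspace_Re_le[of T] _ _ path_image_closed_up_Re])
     (use assms in \<open>auto simp: valid_path_imp_path valid_path_closed_up\<close>)

text \<open>The orientation of the closed loop is read off at a point between two closing edges: it lies
  to the right of the inner loop and inside the clockwise rectangle by which the loops differ.\<close>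

lemma winding_number_inside_closed_up:
  assumes "beyond T" "T < T'" "w \<in> inside (path_image (closed_up T'))"
  shows "winding_number (closed_up T') w = - 1"
proof -
  define w0 where "w0 = Complex ((T + T') / 2) ((\<phi>1 + \<phi>2) / 2)"
  have b': "beyond T'" using assms beyond_mono by fastforce
  have w0: "w0 \<notin> loop_image" "w0 \<notin> path_image (edge T)" "w0 \<notin> path_image (edge T')"
    using assms(1,2) loopD(1) unfolding path_image_edge
    by (auto simp: w0_def loop_image_def beyond_def field_simps)
  have "winding_number (closed_up T) w0 = 0"
    by (rule winding_number_closed_up_right) (use assms in \<open>auto simp: w0_def\<close>)
  moreover have "winding_number (rectpath (Complex T \<phi>1) (Complex T' \<phi>2)) w0 = 1"
    by (rule winding_number_rectpath)
       (use assms(2) loopD(1) in \<open>auto simp: w0_def in_box_complex_iff\<close>)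
  ultimately have m1: "winding_number (closed_up T') w0 = - 1"
    using winding_number_closed_up_diff[OF assms(1) less_imp_le[OF assms(2)] w0] by simp
  have "w0 \<notin> path_image (closed_up T')"
    using w0 truncated_subset[of T'] b' by (auto simp: path_image_closed_up beyond_def)
  moreover have "w0 \<notin> outside (path_image (closed_up T'))"
    using m1 winding_number_zero_in_outside[of "closed_up T'" w0]
    by (auto simp: valid_path_imp_path valid_path_closed_up)
  ultimately have "w0 \<in> inside (path_image (closed_up T'))"
    using inside_Un_outside by blast
  with m1 assms(3) simple_closed_path_winding_number_inside[OF simple_path_closed_up[OF b']]
  show ?thesis by (metis one_neq_neg_one)
qed

text \<open>A point of the infinite loop lies on the closed path for every large cut. This serves
  both sides of the loop, since neither the inside nor the outside of a path contains points of the
  path.\<close>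

lemma not_in_loop_image:
  assumes "\<forall>\<^sub>F T in at_top. w \<notin> path_image (closed_up T)"
  shows "w \<notin> loop_image"
proof
  assume w: "w \<in> loop_image"
  have "\<forall>\<^sub>F T in at_top. w \<notin> path_image (closed_up T) \<and> beyond T \<and> T \<ge> Re w"
    using assms eventually_beyond eventually_ge_at_top by (intro eventually_conj) auto
  then obtain T where "w \<notin> path_image (closed_up T)" "beyond T" "T \<ge> Re w"
    using eventually_happens by fastforce
  thus False using w by (auto simp: path_image_closed_up path_image_truncated loop_image_def beyond_def)
qed

lemma inside_not_in_loop_image: "inside_loop \<phi>1 \<phi>2 R \<gamma> w \<Longrightarrow> w \<notin> loop_image"
  unfolding inside_loop_def
  by (rule not_in_loop_image) (auto simp: inside_def elim!: eventually_mono)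

lemma outside_not_in_loop_image: "outside_loop \<phi>1 \<phi>2 R \<gamma> w \<Longrightarrow> w \<notin> loop_image"
  unfolding outside_loop_def
  by (rule not_in_loop_image) (auto simp: outside_def elim!: eventually_mono)

text \<open>A point to the left of both cuts lies outside the rectangle between them. So the two
  sides of the loop, defined through all large cuts, can be used at one given cut.\<close>

lemma winding_number_closed_up_const:
  assumes "beyond T" "T \<le> T'" "w \<notin> loop_image" "Re w < T"
  shows "winding_number (closed_up T') w = winding_number (closed_up T) w"
proof -
  have "winding_number (rectpath (Complex T \<phi>1) (Complex T' \<phi>2)) w = 0"
    by (rule winding_number_rectpath_outside)
       (use assms loopD(1) in \<open>auto simp: in_cbox_complex_iff\<close>)
  thus ?thesis
    using winding_number_closed_up_diff[OF assms(1-3)] assms(2,4) unfolding path_image_edge by auto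
qed

text \<open>Some cut T' > T has w inside, which forces the clockwise value -1 there; constancy
  carries it back to T.\<close>

lemma winding_number_inside_loop:
  assumes "inside_loop \<phi>1 \<phi>2 R \<gamma> w" "beyond T" "Re w < T"
  shows "winding_number (closed_up T) w = - 1"
proof -
  have "\<forall>\<^sub>F T' in at_top. w \<in> inside (path_image (closed_up T')) \<and> T < T'"
    using assms(1) unfolding inside_loop_def by (intro eventually_conj eventually_gt_at_top)
  then obtain T' where "w \<in> inside (path_image (closed_up T'))" "T < T'"
    using eventually_happens by fastforce
  thus ?thesis
    using winding_number_inside_closed_up[of T T' w] assms
      winding_number_closed_up_const[of T T' w] inside_not_in_loop_image by simp
qed

lemma winding_number_outside_loop:
  assumes "outside_loop \<phi>1 \<phi>2 R \<gamma> w" "beyond T" "Re w < T"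
  shows "winding_number (closed_up T) w = 0"
proof -
  have "\<forall>\<^sub>F T' in at_top. w \<in> outside (path_image (closed_up T')) \<and> T < T'"
    using assms(1) unfolding outside_loop_def by (intro eventually_conj eventually_gt_at_top)
  then obtain T' where "w \<in> outside (path_image (closed_up T'))" "T < T'"
    using eventually_happens by fastforce
  thus ?thesis
    using winding_number_zero_in_outside[of "closed_up T'" w] assms
      winding_number_closed_up_const[of T T' w] outside_not_in_loop_image
    by (simp add: valid_path_imp_path valid_path_closed_up)
qed

end

section \<open>Residues and truncation of the loop integral\<close>

lemma has_contour_integral_horizontal_iff:
  assumes "x < x'"
  shows "(f has_contour_integral I) (linepath (Complex x y) (Complex x' y)) \<longleftrightarrow>
     ((\<lambda>t. f (Complex t y)) has_integral I) {x..x'}"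
proof -
  have "(f has_contour_integral I) (linepath (Complex x y) (Complex x' y)) \<longleftrightarrow>
     ((\<lambda>s. f (s + \<i> * of_real y)) has_contour_integral I) (linepath (of_real x) (of_real x'))"
    unfolding has_contour_integral_linepath
    by (simp add: linepath_def Complex_eq scaleR_conv_of_real algebra_simps)
  also have "\<dots> \<longleftrightarrow> ((\<lambda>t. f (of_real t + \<i> * of_real y)) has_integral I) {x..x'}"
    by (subst has_contour_integral_linepath_Reals_iff) (use assms in auto)
  finally show ?thesis by (simp add: Complex_eq)
qed

text \<open>Domination by B exp (- x) gives absolute integrability, hence existence of the limit and
  not merely a bound for the truncated integrals. Existence matters because \<open>fox_H\<close> is
  defined by \<open>Lim\<close>.\<close>

lemma horizontal_ray_integral:
  assumes "continuous_on {s. Im s = y \<and> x0 \<le> Re s} f"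
    and bound: "\<And>x. x0 \<le> x \<Longrightarrow> norm (f (Complex x y)) \<le> B * exp (- x)"
  shows "\<exists>L. ((\<lambda>T. contour_integral (linepath (Complex x0 y) (Complex T y)) f) \<longlongrightarrow> L) at_top \<and>
             norm L \<le> B * exp (- x0)"
proof -
  define g where "g = (\<lambda>t. f (Complex t y))"
  have cont: "continuous_on {x0..} g"
    unfolding g_def Complex_eq
    by (intro continuous_on_compose2[OF assms(1)] continuous_intros) auto
  have "((\<lambda>x::real. exp (- 1 * x)) has_integral exp (- 1 * x0) / 1) {x0..}"
    by (rule has_integral_exp_minus_to_infinity) simp
  from has_integral_mult_right[OF this, of B]
  have I: "((\<lambda>x. B * exp (- x)) has_integral B * exp (- x0)) {x0..}" by simp
  have ai: "g absolutely_integrable_on {x0..}"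
  proof (rule measurable_bounded_by_integrable_imp_absolutely_integrable)
    show "g \<in> borel_measurable (lebesgue_on {x0..})"
      by (rule continuous_imp_measurable_on_sets_lebesgue[OF cont]) auto
    show "(\<lambda>x. B * exp (- x)) integrable_on {x0..}" using I by (rule has_integral_integrable)
  qed (use bound in \<open>auto simp: g_def\<close>)
  have sub: "g absolutely_integrable_on {x0..T}" for T
    by (rule set_integrable_subset[OF ai]) auto
  have "((\<lambda>T. LINT x:{x0..T}|lebesgue. g x) \<longlongrightarrow> (LINT x:{x0..}|lebesgue. g x)) at_top"
    by (rule tendsto_set_lebesgue_integral_at_top[OF _ ai]) auto
  hence "((\<lambda>T. integral {x0..T} g) \<longlongrightarrow> integral {x0..} g) at_top"
    using set_lebesgue_integral_eq_integral(2)[OF sub] set_lebesgue_integral_eq_integral(2)[OF ai] by simp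
  moreover have "\<forall>\<^sub>F T in at_top. integral {x0..T} g =
      contour_integral (linepath (Complex x0 y) (Complex T y)) f"
    using eventually_gt_at_top[of x0]
  proof eventually_elim
    case (elim T)
    have "(g has_integral integral {x0..T} g) {x0..T}"
      using set_lebesgue_integral_eq_integral(1)[OF sub] by (rule integrable_integral)
    thus ?case
      using has_contour_integral_horizontal_iff[OF elim] contour_integral_unique unfolding g_def by metis
  qed
  ultimately have "((\<lambda>T. contour_integral (linepath (Complex x0 y) (Complex T y)) f)
      \<longlongrightarrow> integral {x0..} g) at_top"
    by (rule Lim_transform_eventually)
  moreover have "norm (integral {x0..} g) \<le> integral {x0..} (\<lambda>x. B * exp (- x))"
    by (rule integral_norm_bound_integral)
       (use set_lebesgue_integral_eq_integral(1)[OF ai] has_integral_integrable[OF I] bound in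
         \<open>auto simp: g_def\<close>)
  ultimately show ?thesis using integral_unique[OF I] by auto
qed

lemma finite_affine_nonpos_Ints:
  fixes c d :: complex
  assumes "d \<noteq> 0" "bounded B"
  shows "finite {s \<in> B. c + d * s \<in> \<int>\<^sub>\<le>\<^sub>0}"
proof -
  obtain r where r: "\<And>s. s \<in> B \<Longrightarrow> norm s \<le> r" using assms(2) by (auto simp: bounded_iff)
  define N where "N = nat \<lceil>norm c + norm d * r\<rceil>"
  have "{s \<in> B. c + d * s \<in> \<int>\<^sub>\<le>\<^sub>0} \<subseteq> (\<lambda>k. (- of_nat k - c) / d) ` {..N}"
  proof
    fix s assume s: "s \<in> {s \<in> B. c + d * s \<in> \<int>\<^sub>\<le>\<^sub>0}"
    then obtain k where k: "c + d * s = - of_nat k" by (auto elim: nonpos_Ints_cases')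
    have "real k = norm (c + d * s)" unfolding k by simp
    also have "\<dots> \<le> norm c + norm d * r"
      using s r norm_triangle_ineq[of c "d * s"] mult_left_mono[of "norm s" r "norm d"]
      by (force simp: norm_mult)
    finally have "k \<le> N" unfolding N_def by linarith
    moreover have "s = (- of_nat k - c) / d" using k assms(1) by (simp add: field_simps)
    ultimately show "s \<in> (\<lambda>k. (- of_nat k - c) / d) ` {..N}" by blast
  qed
  thus ?thesis by (rule finite_subset) simp
qed

text \<open>The second factor is the effect of arg z on a complex exponent; for bounded
  \<open>Im (lg z)\<close> and bounded Im c it stays between positive constants.\<close>

lemma norm_zpow:
  assumes "log_branch lg" "z \<noteq> 0"
  shows "norm (zpow lg z c) = norm z powr Re c * exp (- (Im c * Im (lg z)))"
proof -
  have "exp (lg z) = z" using assms by (simp add: log_branch_def)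
  hence "norm z = exp (Re (lg z))" by (metis norm_exp_eq_Re)
  thus ?thesis by (simp add: zpow_def powr_def exp_add[symmetric])
qed

lemma log_branch_bounded_Im:
  assumes "log_branch lg"
  shows "\<exists>M\<ge>0. \<forall>z. z \<noteq> 0 \<longrightarrow> \<bar>Im (lg z)\<bar> \<le> M"
proof -
  obtain M where "\<And>z. z \<noteq> 0 \<Longrightarrow> \<bar>Im (lg z)\<bar> \<le> M"
    using assms by (force simp: log_branch_def bounded_iff)
  thus ?thesis by (intro exI[of _ "max 0 M"]) (auto simp: le_max_iff_disj)
qed

locale fox_setup = unbounded_loop \<phi>1 \<phi>2 R \<gamma> for \<phi>1 \<phi>2 R :: real and \<gamma> :: "real \<Rightarrow> complex" +
  fixes m n p q :: nat and a b :: "nat \<Rightarrow> complex" and \<alpha> \<beta> :: "nat \<Rightarrow> real"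
    and lg :: "complex \<Rightarrow> complex"
  assumes mq: "m \<le> q" and np: "n \<le> p"
    and \<alpha>_pos: "\<forall>i\<in>{1..p}. \<alpha> i > 0"
    and \<beta>_pos: "\<forall>j\<in>{1..q}. \<beta> j > 0"
    and poles_separate: "\<forall>i\<in>{1..n}. \<forall>j\<in>{1..m}. \<forall>k l :: nat.
           of_real (\<beta> j) * (a i - 1 - of_nat k) \<noteq> of_real (\<alpha> i) * (b j + of_nat l)"
    and poles_simple: "\<forall>i\<in>{1..n}. \<forall>j\<in>{1..n}. i \<noteq> j \<longrightarrow> (\<forall>k l :: nat.
           of_real (\<alpha> j) * (1 - a i + of_nat k) \<noteq> of_real (\<alpha> i) * (1 - a j + of_nat l))"
    and Delta_neg: "fox_Delta p q \<alpha> \<beta> < 0"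
    and branch: "log_branch lg"
    and fox_loop: "fox_loop m n a \<alpha> b \<beta> \<phi>1 \<phi>2 R \<gamma>"
begin

abbreviation K :: "complex \<Rightarrow> complex" where
  "K \<equiv> fox_kernel m n p q a \<alpha> b \<beta>"

abbreviation H :: "complex \<Rightarrow> complex" where
  "H \<equiv> fox_H m n p q a \<alpha> b \<beta> \<phi>1 \<phi>2 R \<gamma> lg"

abbreviation coeff :: "nat \<Rightarrow> nat \<Rightarrow> complex" where
  "coeff \<equiv> fox_coeff m n p q a \<alpha> b \<beta>"

section \<open>The two families of poles and their position relative to the loop\<close>

definition pole :: "nat \<Rightarrow> nat \<Rightarrow> complex" where
  "pole i k = (1 - a i + of_nat k) / of_real (\<alpha> i)"

definition a_poles :: "complex set" where
  "a_poles = {s. \<exists>i\<in>{1..n}. 1 - a i - of_real (\<alpha> i) * s \<in> \<int>\<^sub>\<le>\<^sub>0}"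

definition b_poles :: "complex set" where
  "b_poles = {s. \<exists>j\<in>{1..m}. b j + of_real (\<beta> j) * s \<in> \<int>\<^sub>\<le>\<^sub>0}"

text \<open>Pairs of indices rather than points, to match the index set of the series;
  \<open>inj_on_pole\<close> translates sums over points into sums over pairs.\<close>

definition left_poles :: "real \<Rightarrow> (nat \<times> nat) set" where
  "left_poles T = {t \<in> {1..n} \<times> UNIV. Re (pole (fst t) (snd t)) < T}"

lemma param_pos: "i \<in> {1..n} \<Longrightarrow> \<alpha> i > 0" "j \<in> {1..m} \<Longrightarrow> \<beta> j > 0"
  using \<alpha>_pos \<beta>_pos mq np by auto

lemma a_pole_iff:
  assumes "i \<in> {1..n}"
  shows "1 - a i - of_real (\<alpha> i) * s \<in> \<int>\<^sub>\<le>\<^sub>0 \<longleftrightarrow> (\<exists>k. s = pole i k)"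
proof -
  have "1 - a i - of_real (\<alpha> i) * s = - of_nat k \<longleftrightarrow> s = pole i k" for k
    using param_pos(1)[OF assms] by (auto simp: pole_def field_simps)
  thus ?thesis by (metis nonpos_Ints_cases' minus_of_nat_in_nonpos_Ints)
qed

lemma a_poles_eq: "a_poles = (\<lambda>t. pole (fst t) (snd t)) ` ({1..n} \<times> UNIV)"
proof -
  have "a_poles = {s. \<exists>i\<in>{1..n}. \<exists>k. s = pole i k}"
    unfolding a_poles_def using a_pole_iff by blast
  thus ?thesis by force
qed

text \<open>For different i and j, \<open>poles_simple\<close> says that two poles differ, with
  denominators cleared; within one family they are distinct because k can be read off.\<close>

lemma inj_on_pole: "inj_on (\<lambda>t. pole (fst t) (snd t)) ({1..n} \<times> UNIV)"
proof (rule inj_onI, clarify)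
  fix i k j l assume ij: "i \<in> {1..n}" "j \<in> {1..n}" and eq: "pole (fst (i, k)) (snd (i, k)) = pole (fst (j, l)) (snd (j, l))"
  have "of_real (\<alpha> j) * (1 - a i + of_nat k) = of_real (\<alpha> i) * (1 - a j + of_nat l)"
    using eq param_pos(1)[OF ij(1)] param_pos(1)[OF ij(2)] by (auto simp: pole_def field_simps)
  hence "i = j" using poles_simple ij by blast
  moreover have "k = l" using eq param_pos(1)[OF ij(1)] \<open>i = j\<close> by (simp add: pole_def)
  ultimately show "i = j \<and> k = l" by simp
qed

lemma a_poles_disjoint: "a_poles \<inter> b_poles = {}"
proof -
  have False if "i \<in> {1..n}" "j \<in> {1..m}" "b j + of_real (\<beta> j) * pole i k = - of_nat l" for i j k l
  proof -
    have "of_real (\<beta> j) * (a i - 1 - of_nat k) = - (of_real (\<alpha> i) * (of_real (\<beta> j) * pole i k))"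
      using param_pos(1)[OF that(1)] by (simp add: pole_def field_simps)
    also have "of_real (\<beta> j) * pole i k = - of_nat l - b j"
      using that(3) by (simp add: algebra_simps)
    finally show False using poles_separate that(1,2) by (auto simp: algebra_simps)
  qed
  thus ?thesis
    unfolding a_poles_eq by (fastforce simp: b_poles_def elim!: nonpos_Ints_cases')
qed

lemma closed_poles: "closed (a_poles \<union> b_poles)"
proof -
  have "a_poles = (\<Union>i\<in>{1..n}. (\<lambda>s. 1 - a i - of_real (\<alpha> i) * s) -` \<int>\<^sub>\<le>\<^sub>0)"
    by (auto simp: a_poles_def)
  moreover have "b_poles = (\<Union>j\<in>{1..m}. (\<lambda>s. b j + of_real (\<beta> j) * s) -` \<int>\<^sub>\<le>\<^sub>0)"
    by (auto simp: b_poles_def)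
  ultimately show ?thesis
    by (auto intro!: closed_Un closed_UN closed_vimage continuous_intros)
qed

lemma finite_poles:
  assumes "bounded B"
  shows "finite ((a_poles \<union> b_poles) \<inter> B)"
proof -
  have "(a_poles \<union> b_poles) \<inter> B =
     (\<Union>i\<in>{1..n}. {s\<in>B. (1 - a i) + (- of_real (\<alpha> i)) * s \<in> \<int>\<^sub>\<le>\<^sub>0}) \<union>
     (\<Union>j\<in>{1..m}. {s\<in>B. b j + of_real (\<beta> j) * s \<in> \<int>\<^sub>\<le>\<^sub>0})"
    by (auto simp: a_poles_def b_poles_def)
  also have "finite \<dots>"
    using param_pos
    by (intro finite_UnI finite_UN_I finite_affine_nonpos_Ints assms) (auto simp: less_le)
  finally show ?thesis .
qed

lemma finite_left_poles: "finite (left_poles T)"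
proof -
  have "left_poles T \<subseteq> (\<Union>i\<in>{1..n}. {i} \<times> {..nat \<lceil>T * \<alpha> i - 1 + Re (a i)\<rceil>})"
  proof
    fix t assume t: "t \<in> left_poles T"
    obtain i k where [simp]: "t = (i, k)" by (cases t)
    have i: "i \<in> {1..n}" and "Re (pole i k) < T" using t by (auto simp: left_poles_def)
    hence "1 - Re (a i) + real k < T * \<alpha> i"
      using param_pos(1)[OF i] by (simp add: pole_def Re_divide_of_real field_simps)
    hence "k \<le> nat \<lceil>T * \<alpha> i - 1 + Re (a i)\<rceil>" by linarith
    thus "t \<in> (\<Union>i\<in>{1..n}. {i} \<times> {..nat \<lceil>T * \<alpha> i - 1 + Re (a i)\<rceil>})" using i by auto
  qed
  thus ?thesis by (rule finite_subset) auto
qed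

lemma b_poles_bounded: "\<forall>\<^sub>F T in at_top. \<forall>s\<in>b_poles. Re s < T"
proof -
  have "\<forall>\<^sub>F T in at_top. \<forall>j\<in>{1..m}. - Re (b j) / \<beta> j < T"
    by (intro eventually_ball_finite ballI eventually_gt_at_top) auto
  thus ?thesis
  proof eventually_elim
    case (elim T)
    show ?case
    proof
      fix s assume "s \<in> b_poles"
      then obtain j k where j: "j \<in> {1..m}" and eq: "b j + of_real (\<beta> j) * s = - of_nat k"
        by (auto simp: b_poles_def elim!: nonpos_Ints_cases')
      have "Re (b j) + \<beta> j * Re s = - real k" using arg_cong[OF eq, of Re] by simp
      hence "\<beta> j * Re s \<le> - Re (b j)" by simp
      hence "Re s \<le> - Re (b j) / \<beta> j" using param_pos(2)[OF j] by (simp add: field_simps)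
      thus "Re s < T" using elim j by fastforce
    qed
  qed
qed

lemma holomorphic_kernel: "K holomorphic_on - (a_poles \<union> b_poles)"
  unfolding fox_kernel_def
  by (intro holomorphic_intros) (auto simp: a_poles_def b_poles_def)

lemma holomorphic_integrand: "(\<lambda>s. K s * zpow lg z (- s)) holomorphic_on - (a_poles \<union> b_poles)"
  unfolding zpow_def by (intro holomorphic_intros holomorphic_kernel)

lemma inside_a_poles: "s \<in> a_poles \<Longrightarrow> inside_loop \<phi>1 \<phi>2 R \<gamma> s"
  using fox_loop by (auto simp: fox_loop_def a_poles_def)

lemma outside_b_poles: "s \<in> b_poles \<Longrightarrow> outside_loop \<phi>1 \<phi>2 R \<gamma> s"
  using fox_loop by (auto simp: fox_loop_def b_poles_def)

lemma loop_image_avoids_poles: "loop_image \<subseteq> - (a_poles \<union> b_poles)"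
  using inside_a_poles outside_b_poles inside_not_in_loop_image outside_not_in_loop_image by blast

text \<open>The poles \<open>pole i k\<close> share one ordinate, and their real parts tend to
  infinity with k. If that ordinate were \<phi>1 or \<phi>2, a pole with large k would lie on the
  loop. This is the condition that keeps the reflected sine away from 0.\<close>

lemma poles_off_half_lines:
  assumes i: "i \<in> {1..n}" and y: "y = \<phi>1 \<or> y = \<phi>2"
  shows "Im (a i) + \<alpha> i * y \<noteq> 0"
proof
  assume eq: "Im (a i) + \<alpha> i * y = 0"
  define k where "k = nat \<lceil>R * \<alpha> i - 1 + Re (a i)\<rceil>"
  have "R * \<alpha> i \<le> 1 - Re (a i) + real k" unfolding k_def by linarith
  hence "R \<le> Re (pole i k)"
    using param_pos(1)[OF i] by (simp add: pole_def Re_divide_of_real field_simps)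
  moreover have "Im (pole i k) = y"
    using eq param_pos(1)[OF i] by (simp add: pole_def Im_divide_of_real field_simps)
  ultimately have "pole i k \<in> loop_image" using y by (auto simp: loop_image_def)
  moreover have "pole i k \<in> a_poles" using i by (force simp: a_poles_eq)
  ultimately show False using loop_image_avoids_poles by blast
qed

text \<open>For n = 0 there is no reflected Gamma factor in the numerator, so the decay holds on
  every compact set of ordinates; otherwise it is claimed on the two boundary lines only.\<close>

lemma kernel_decay:
  assumes "compact S" "S \<subseteq> {\<phi>1, \<phi>2} \<or> n = 0"
  shows "\<forall>\<^sub>F x in at_top. \<forall>y\<in>S. norm (K (Complex x y)) \<le> exp (- x)"
proof (rule strip_growth_negative[OF _ Delta_neg])
  show "strip_growth S K (fox_Delta p q \<alpha> \<beta>)"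
    by (rule strip_growth_fox_kernel[OF mq np \<alpha>_pos \<beta>_pos assms(1)])
       (use poles_off_half_lines assms(2) in auto)
qed

text \<open>Only the i-th factor is singular: Gamma has residue (-1)^k / k! at -k, and the slope
  -\<alpha>_i of its argument divides it by -\<alpha>_i. All other factors are continuous at the
  pole and are evaluated there.\<close>

lemma residue_integrand:
  assumes i: "i \<in> {1..n}"
  shows "residue (\<lambda>s. K s * zpow lg z (- s)) (pole i k) = - (coeff i k * zpow lg z (- pole i k))"
proof -
  define s0 where "s0 = pole i k"
  define w where "w = (\<lambda>s. 1 - a i - of_real (\<alpha> i) * s)"
  define g where "g = (\<lambda>s.
     (\<Prod>j=1..m. Gamma (b j + of_real (\<beta> j) * s)) *
     (\<Prod>j\<in>{1..n} - {i}. Gamma (1 - a j - of_real (\<alpha> j) * s)) *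
     (\<Prod>i=n+1..p. rGamma (a i + of_real (\<alpha> i) * s)) *
     (\<Prod>j=m+1..q. rGamma (1 - b j - of_real (\<beta> j) * s)) * zpow lg z (- s))"
  note \<alpha>i = param_pos(1)[OF i]
  have s0: "s0 \<in> a_poles" using i by (force simp: s0_def a_poles_eq)
  have ws0: "w s0 = - of_nat k" using \<alpha>i by (simp add: w_def s0_def pole_def)
  have "(\<Prod>j=1..n. Gamma (1 - a j - of_real (\<alpha> j) * s)) =
      Gamma (w s) * (\<Prod>j\<in>{1..n} - {i}. Gamma (1 - a j - of_real (\<alpha> j) * s))" for s
    unfolding w_def by (rule prod.remove) (use i in auto)
  hence Kg: "K s * zpow lg z (- s) = Gamma (w s) * g s" for s
    by (simp add: fox_kernel_def g_def)
  have nb: "b j + of_real (\<beta> j) * s0 \<notin> \<int>\<^sub>\<le>\<^sub>0" if "j \<in> {1..m}" for j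
    using a_poles_disjoint s0 that unfolding b_poles_def by blast
  have na: "1 - a j - of_real (\<alpha> j) * s0 \<notin> \<int>\<^sub>\<le>\<^sub>0" if "j \<in> {1..n} - {i}" for j
  proof
    assume "1 - a j - of_real (\<alpha> j) * s0 \<in> \<int>\<^sub>\<le>\<^sub>0"
    moreover have "j \<in> {1..n}" using that by simp
    ultimately obtain l where "s0 = pole j l" using a_pole_iff by blast
    hence "(i, k) = (j, l)"
      using i that by (intro inj_onD[OF inj_on_pole]) (auto simp: s0_def)
    thus False using that by simp
  qed
  have "isCont g s0"
    unfolding g_def zpow_def using na nb by (intro continuous_intros isCont_Gamma isCont_rGamma) auto
  hence g: "g \<midarrow>s0\<rightarrow> g s0" by (simp add: isCont_def)
  have "isCont w s0" unfolding w_def by (intro continuous_intros)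
  hence "w \<midarrow>s0\<rightarrow> - of_nat k" using ws0 by (simp add: isCont_def)
  have ws: "w s + of_nat k = - (of_real (\<alpha> i) * (s - s0))" for s
    using ws0 by (simp add: w_def algebra_simps)
  \<comment> \<open>\<open>Gamma_residues\<close> is a limit over a punctured neighbourhood of -k,
    so w has to avoid the value -k off s0.\<close>
  have "w s \<noteq> - of_nat k" if "s \<noteq> s0" for s
    using ws[of s] that \<alpha>i by auto
  hence "\<forall>\<^sub>F s in at s0. w s \<noteq> - of_nat k"
    using eventually_neq_at_within[of s0 s0 UNIV] by (auto elim!: eventually_mono)
  with \<open>w \<midarrow>s0\<rightarrow> - of_nat k\<close> have "filterlim w (at (- of_nat k)) (at s0)"
    by (auto simp: filterlim_at)
  from filterlim_compose[OF Gamma_residues this]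
  have "(\<lambda>s. Gamma (w s) * (w s + of_nat k)) \<midarrow>s0\<rightarrow> (- 1) ^ k / fact k" .
  from tendsto_mult[OF this tendsto_mult[OF tendsto_const[of "- 1 / of_real (\<alpha> i)"] g]]
  have lim: "(\<lambda>s. K s * zpow lg z (- s) * (s - s0)) \<midarrow>s0\<rightarrow>
      (- 1) ^ k / fact k * (- 1 / of_real (\<alpha> i) * g s0)"
  proof (rule Lim_transform_eventually, intro always_eventually allI)
    fix s
    show "Gamma (w s) * (w s + of_nat k) * (- 1 / of_real (\<alpha> i) * g s) =
        K s * zpow lg z (- s) * (s - s0)"
      using \<alpha>i unfolding Kg ws by simp
  qed
  \<comment> \<open>The residue is read off the limit on a punctured ball that has to be free of
    other poles; the unit ball contains finitely many, so a small radius will do.\<close>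
  obtain d where d: "d > 0" "\<And>x. x \<in> (a_poles \<union> b_poles) \<inter> ball s0 1 \<Longrightarrow> x \<noteq> s0 \<Longrightarrow> d \<le> dist s0 x"
    using finite_set_avoid[OF finite_poles[OF bounded_ball, of s0 1], of s0] by blast
  have "residue (\<lambda>s. K s * zpow lg z (- s)) s0 = (- 1) ^ k / fact k * (- 1 / of_real (\<alpha> i) * g s0)"
  proof (rule residue_simple'[OF _ _ _ lim])
    show "(\<lambda>s. K s * zpow lg z (- s)) holomorphic_on ball s0 (min d 1) - {s0}"
      by (rule holomorphic_on_subset[OF holomorphic_integrand]) (use d(2) in force)
  qed (use d(1) in auto)
  also have "g s0 = (\<Prod>j=1..m. Gamma (b j + (1 - a i + of_nat k) * of_real (\<beta> j / \<alpha> i))) *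
     (\<Prod>j\<in>{1..n} - {i}. Gamma (1 - a j - (1 - a i + of_nat k) * of_real (\<alpha> j / \<alpha> i))) *
     (\<Prod>j=n+1..p. rGamma (a j + (1 - a i + of_nat k) * of_real (\<alpha> j / \<alpha> i))) *
     (\<Prod>j=m+1..q. rGamma (1 - b j - (1 - a i + of_nat k) * of_real (\<beta> j / \<alpha> i))) * zpow lg z (- s0)"
    by (simp add: g_def s0_def pole_def mult.commute)
  finally show ?thesis
    using \<alpha>i by (simp add: s0_def fox_coeff_def mult_ac)
qed

text \<open>Winding number -1 at the enclosed poles meets the minus sign of
  \<open>residue_integrand\<close>, so the partial sum of the series appears with a plus.\<close>

lemma contour_integral_closed_up_residues:
  assumes T: "beyond T" "\<And>s. s \<in> a_poles \<union> b_poles \<Longrightarrow> Re s \<noteq> T" "\<And>s. s \<in> b_poles \<Longrightarrow> Re s < T"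
  shows "contour_integral (closed_up T) (\<lambda>s. K s * zpow lg z (- s)) =
     2 * of_real pi * \<i> * (\<Sum>t\<in>left_poles T. coeff (fst t) (snd t) * zpow lg z (- pole (fst t) (snd t)))"
proof -
  define f where "f = (\<lambda>s. K s * zpow lg z (- s))"
  define P where "P = (\<lambda>t. pole (fst t) (snd t)) ` left_poles T"
  have "bounded (path_image (closed_up T) \<union> P)"
    unfolding P_def using bounded_path_image[OF valid_path_imp_path[OF valid_path_closed_up]]
      finite_imp_bounded[OF finite_imageI[OF finite_left_poles]] by simp
  then obtain r where r: "path_image (closed_up T) \<union> P \<subseteq> ball 0 r"
    using bounded_subset_ballD by blast
  define pts where "pts = (a_poles \<union> b_poles) \<inter> ball 0 r"
  have P: "P = {s \<in> a_poles. Re s < T}"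
    by (auto simp: P_def a_poles_eq left_poles_def)
  have edgeT: "path_image (edge T) \<subseteq> {s. Re s = T}" unfolding path_image_edge by auto
  have fin: "finite pts" unfolding pts_def by (rule finite_poles) simp
  have "contour_integral (closed_up T) f =
      2 * pi * \<i> * (\<Sum>s\<in>pts. winding_number (closed_up T) s * residue f s)"
  proof (rule Residue_theorem[of "ball 0 r"])
    show "f holomorphic_on ball 0 r - pts"
      unfolding f_def by (rule holomorphic_on_subset[OF holomorphic_integrand]) (auto simp: pts_def)
    show "path_image (closed_up T) \<subseteq> ball 0 r - pts"
      using r T loop_image_avoids_poles truncated_subset[of T] edgeT
      by (auto simp: path_image_closed_up pts_def beyond_def simp del: path_image_linepath)
    show "\<forall>s. s \<notin> ball 0 r \<longrightarrow> winding_number (closed_up T) s = 0"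
      using r by (auto intro!: winding_number_zero_outside[of _ "ball 0 r"] valid_path_imp_path
          valid_path_closed_up)
  qed (use fin valid_path_closed_up in auto)
  \<comment> \<open>What is left of \<open>pts\<close> outside \<open>P\<close> contributes 0: it
    consists of poles outside the loop and of poles to the right of the edge.\<close>
  also have "(\<Sum>s\<in>pts. winding_number (closed_up T) s * residue f s) = (\<Sum>s\<in>P. - residue f s)"
  proof (rule sum.mono_neutral_cong_right[OF fin])
    show "P \<subseteq> pts" using r P by (auto simp: pts_def)
    show "\<forall>s\<in>pts - P. winding_number (closed_up T) s * residue f s = 0"
    proof
      fix s assume s: "s \<in> pts - P"
      have "winding_number (closed_up T) s = 0"
      proof (cases "s \<in> b_poles")
        case True
        thus ?thesis using winding_number_outside_loop[OF outside_b_poles T(1)] T(3) by blast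
      next
        case False
        hence "T < Re s" using s P T(2)[of s] by (auto simp: pts_def)
        thus ?thesis by (rule winding_number_closed_up_right[OF T(1)])
      qed
      thus "winding_number (closed_up T) s * residue f s = 0" by simp
    qed
    show "winding_number (closed_up T) s * residue f s = - residue f s" if "s \<in> P" for s
      using that winding_number_inside_loop[OF inside_a_poles T(1)] by (simp add: P)
  qed
  also have "\<dots> = (\<Sum>t\<in>left_poles T. - residue f (pole (fst t) (snd t)))"
    unfolding P_def
    by (subst sum.reindex) (auto intro!: inj_on_subset[OF inj_on_pole] simp: left_poles_def)
  also have "\<dots> = (\<Sum>t\<in>left_poles T. coeff (fst t) (snd t) * zpow lg z (- pole (fst t) (snd t)))"
    unfolding f_def by (intro sum.cong refl) (auto simp: residue_integrand left_poles_def)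
  finally show ?thesis unfolding f_def by simp
qed

section \<open>The error made by cutting the loop at Re s = T\<close>

text \<open>\<open>C\<close> is fixed before T, z and D. The bound D on the edge is left as a
  parameter: for one fixed T it comes from compactness, while for n = 0 it can be taken as exp (-
  T).\<close>

lemma fox_H_truncation:
  "\<exists>C\<ge>0. \<forall>\<^sub>F T in at_top. (\<forall>s\<in>a_poles. Re s \<noteq> T) \<longrightarrow>
     (\<forall>D z. (\<forall>y\<in>{\<phi>1..\<phi>2}. norm (K (Complex T y)) \<le> D) \<longrightarrow> 1 \<le> norm z \<longrightarrow>
        norm (H z - (\<Sum>t\<in>left_poles T. coeff (fst t) (snd t) * zpow lg z (- pole (fst t) (snd t))))
          \<le> C * (D + exp (- T)) * norm z powr (- T))"
proof -
  obtain M where M: "M \<ge> 0" "\<And>z. z \<noteq> 0 \<Longrightarrow> \<bar>Im (lg z)\<bar> \<le> M"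
    using log_branch_bounded_Im[OF branch] by blast
  \<comment> \<open>Between the half-lines |Im s| \<le> \<Phi>, so \<open>E\<close> bounds the
    factor of |z^(-s)| that comes from the argument of z.\<close>
  define \<Phi> where "\<Phi> = max \<bar>\<phi>1\<bar> \<bar>\<phi>2\<bar>"
  define E where "E = exp (\<Phi> * M)"
  have zp: "norm (zpow lg z (- s)) \<le> E * norm z powr (- T)"
    if "1 \<le> norm z" "T \<le> Re s" "\<phi>1 \<le> Im s" "Im s \<le> \<phi>2" for z s T
  proof -
    have "z \<noteq> 0" using that by auto
    have "\<bar>Im s\<bar> \<le> \<Phi>" using that by (auto simp: \<Phi>_def)
    hence "\<bar>Im s * Im (lg z)\<bar> \<le> \<Phi> * M"
      unfolding abs_mult using M \<open>z \<noteq> 0\<close> by (intro mult_mono) auto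
    hence "exp (Im s * Im (lg z)) \<le> E" by (simp add: E_def)
    moreover have "norm z powr (- Re s) \<le> norm z powr (- T)"
      using that by (intro powr_mono) auto
    ultimately show ?thesis
      using norm_zpow[OF branch \<open>z \<noteq> 0\<close>, of "- s"]
        mult_mono[of "exp (Im s * Im (lg z))" E "norm z powr (- Re s)" "norm z powr (- T)"]
      by (simp add: mult.commute E_def)
  qed
  obtain X where X: "\<And>x. x \<ge> X \<Longrightarrow> norm (K (Complex x \<phi>1)) \<le> exp (- x)"
     "\<And>x. x \<ge> X \<Longrightarrow> norm (K (Complex x \<phi>2)) \<le> exp (- x)"
    using kernel_decay[of "{\<phi>1, \<phi>2}"] by (auto simp: eventually_at_top_linorder)
  \<comment> \<open>The edge has length \<phi>2 - \<phi>1, and the two half-lines contribute exp (-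
    T) each; the prefactor 1 / (2 pi) is estimated by 1.\<close>
  define C where "C = E * (\<phi>2 - \<phi>1 + 2)"
  have "C \<ge> 0" using loopD(1) by (simp add: C_def E_def)
  moreover have "\<forall>\<^sub>F T in at_top. (\<forall>s\<in>a_poles. Re s \<noteq> T) \<longrightarrow>
     (\<forall>D z. (\<forall>y\<in>{\<phi>1..\<phi>2}. norm (K (Complex T y)) \<le> D) \<longrightarrow> 1 \<le> norm z \<longrightarrow>
        norm (H z - (\<Sum>t\<in>left_poles T. coeff (fst t) (snd t) * zpow lg z (- pole (fst t) (snd t))))
          \<le> C * (D + exp (- T)) * norm z powr (- T))"
    using eventually_ge_at_top[of X] eventually_beyond b_poles_bounded
  proof eventually_elim
    case (elim T)
    show ?case
    proof (intro impI allI)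
      fix D and z :: complex
      assume noT: "\<forall>s\<in>a_poles. Re s \<noteq> T" and D: "\<forall>y\<in>{\<phi>1..\<phi>2}. norm (K (Complex T y)) \<le> D"
        and z: "1 \<le> norm z"
      define f where "f = (\<lambda>s. K s * zpow lg z (- s))"
      define U where "U = - (a_poles \<union> b_poles)"
      define B where "B = E * norm z powr (- T)"
      have B0: "B \<ge> 0" by (simp add: B_def E_def)
      have RT: "R < T" using elim by (simp add: beyond_def)
      have "norm (K (Complex T \<phi>1)) \<le> D" using D loopD(1) by auto
      hence D0: "D \<ge> 0" using norm_ge_zero order_trans by blast
      have hol: "f holomorphic_on U" unfolding f_def U_def by (rule holomorphic_integrand)
      have U: "open U" "loop_image \<subseteq> U"
        unfolding U_def using closed_poles loop_image_avoids_poles by (simp_all only: open_Compl)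
      have cont: "continuous_on U f" by (rule holomorphic_on_imp_continuous_on[OF hol])
      have edgeU: "path_image (edge T) \<subseteq> U"
        unfolding path_image_edge using noT elim by (fastforce simp: U_def)
      have ray: "\<exists>L. ((\<lambda>T'. contour_integral (linepath (Complex T y) (Complex T' y)) f) \<longlongrightarrow> L) at_top \<and>
             norm L \<le> B * exp (- T)" if y: "y = \<phi>1 \<or> y = \<phi>2" for y
      proof (rule horizontal_ray_integral)
        show "continuous_on {s. Im s = y \<and> T \<le> Re s} f"
          by (rule continuous_on_subset[OF cont]) (use y RT U(2) in \<open>auto simp: loop_image_def\<close>)
        fix x assume x: "T \<le> x"
        have "norm (K (Complex x y)) \<le> exp (- x)" using X x y elim by auto
        moreover have "norm (zpow lg z (- Complex x y)) \<le> B"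
          unfolding B_def by (rule zp) (use z x y loopD(1) in auto)
        ultimately have "norm (f (Complex x y)) \<le> exp (- x) * B"
          unfolding f_def norm_mult by (intro mult_mono) auto
        thus "norm (f (Complex x y)) \<le> B * exp (- x)" by (simp add: mult.commute)
      qed
      obtain L1 where L1: "((\<lambda>T'. contour_integral (linepath (Complex T \<phi>1) (Complex T' \<phi>1)) f) \<longlongrightarrow> L1) at_top"
        "norm L1 \<le> B * exp (- T)" using ray by blast
      obtain L2 where L2: "((\<lambda>T'. contour_integral (linepath (Complex T \<phi>2) (Complex T' \<phi>2)) f) \<longlongrightarrow> L2) at_top"
        "norm L2 \<le> B * exp (- T)" using ray by blast
      have edge_le: "norm (contour_integral (edge T) f) \<le> (D * B) * norm (Complex T \<phi>1 - Complex T \<phi>2)"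
      proof (rule contour_integral_bound_linepath)
        show "f contour_integrable_on edge T"
          using edgeU by (intro contour_integrable_continuous_linepath continuous_on_subset[OF cont]) simp
        fix s assume "s \<in> closed_segment (Complex T \<phi>2) (Complex T \<phi>1)"
        hence s: "Re s = T" "\<phi>1 \<le> Im s" "Im s \<le> \<phi>2"
          using loopD(1) by (auto simp: closed_segment_vertical)
        hence "norm (K (Complex T (Im s))) \<le> D" using D by auto
        hence "norm (K s) \<le> D" using s(1) by (metis complex_surj)
        moreover have "norm (zpow lg z (- s)) \<le> B" unfolding B_def by (rule zp) (use s z in auto)
        ultimately show "norm (f s) \<le> D * B"
          unfolding f_def norm_mult using D0 by (intro mult_mono) auto
      qed (use D0 B0 in auto)
      have "norm (Complex T \<phi>1 - Complex T \<phi>2) = \<phi>2 - \<phi>1"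
        using loopD(1) by (simp add: cmod_def)
      with edge_le have edge_le: "norm (contour_integral (edge T) f) \<le> D * B * (\<phi>2 - \<phi>1)" by simp
      \<comment> \<open>The loop integral is a limit over cuts T' while T stays fixed: only the two
        pieces beyond T vary.\<close>
      have "((\<lambda>T'. contour_integral (truncated T) f
          + contour_integral (linepath (Complex T \<phi>2) (Complex T' \<phi>2)) f
          - contour_integral (linepath (Complex T \<phi>1) (Complex T' \<phi>1)) f)
          \<longlongrightarrow> contour_integral (truncated T) f + L2 - L1) at_top"
        by (intro tendsto_intros L1 L2)
      hence "((\<lambda>T'. contour_integral (truncated T') f) \<longlongrightarrow> contour_integral (truncated T) f + L2 - L1) at_top"
        by (rule Lim_transform_eventually)
           (rule eventually_mono[OF eventually_ge_at_top[of T]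
               contour_integral_truncated(1)[OF elim(2) _ U hol, symmetric]])
      hence "Lim at_top (\<lambda>T'. contour_integral (truncated T') f) = contour_integral (truncated T) f + L2 - L1"
        by (intro tendsto_Lim trivial_limit_at_top_linorder)
      moreover have "contour_integral (closed_up T) f = contour_integral (truncated T) f + contour_integral (edge T) f"
        by (rule contour_integral_closed_up[OF elim(2) U hol edgeU])
      moreover have "contour_integral (closed_up T) f = 2 * of_real pi * \<i> *
          (\<Sum>t\<in>left_poles T. coeff (fst t) (snd t) * zpow lg z (- pole (fst t) (snd t)))"
        unfolding f_def
        by (rule contour_integral_closed_up_residues) (use elim noT in force)+
      ultimately have "H z - (\<Sum>t\<in>left_poles T. coeff (fst t) (snd t) * zpow lg z (- pole (fst t) (snd t)))
          = 1 / (2 * of_real pi * \<i>) * (L2 - L1 - contour_integral (edge T) f)"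
        unfolding fox_H_def f_def[symmetric] by (simp add: divide_simps) (simp add: algebra_simps)
      also have "norm \<dots> \<le> 1 * norm (L2 - L1 - contour_integral (edge T) f)"
        unfolding norm_mult using pi_gt3
        by (intro mult_right_mono) (auto simp: norm_divide norm_mult field_simps)
      also have "\<dots> \<le> norm L2 + norm L1 + norm (contour_integral (edge T) f)"
        using norm_triangle_ineq4[of "L2 - L1" "contour_integral (edge T) f"] norm_triangle_ineq4[of L2 L1]
        by simp
      also have "\<dots> \<le> B * exp (- T) + B * exp (- T) + D * B * (\<phi>2 - \<phi>1)"
        using L1 L2 edge_le by linarith
      \<comment> \<open>Nonnegative mixed terms are added so that D and exp (- T) get a common
        factor.\<close>
      also have "\<dots> \<le> B * ((\<phi>2 - \<phi>1 + 2) * (D + exp (- T)))"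
      proof -
        have "(\<phi>2 - \<phi>1 + 2) * (D + exp (- T)) =
            2 * exp (- T) + D * (\<phi>2 - \<phi>1) + ((\<phi>2 - \<phi>1) * exp (- T) + 2 * D)"
          by (simp add: algebra_simps)
        moreover have "0 \<le> (\<phi>2 - \<phi>1) * exp (- T) + 2 * D" using loopD(1) D0 by simp
        ultimately have "2 * exp (- T) + D * (\<phi>2 - \<phi>1) \<le> (\<phi>2 - \<phi>1 + 2) * (D + exp (- T))"
          by linarith
        from mult_left_mono[OF this B0] show ?thesis by (simp add: algebra_simps)
      qed
      also have "\<dots> = C * (D + exp (- T)) * norm z powr (- T)" by (simp add: B_def C_def)
      finally show "norm (H z - (\<Sum>t\<in>left_poles T. coeff (fst t) (snd t) * zpow lg z (- pole (fst t) (snd t))))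
          \<le> C * (D + exp (- T)) * norm z powr (- T)" .
    qed
  qed
  ultimately show ?thesis by blast
qed

end

section \<open>Asymptotic expansion\<close>

text \<open>Both directions are needed: the upper bound estimates the terms of the series, and the
  lower one turns an error in |z| back into an error in the complex power z^((a_i - 2) /
  \<alpha>_i).\<close>

lemma norm_zpow_bounds:
  assumes "log_branch lg"
  shows "\<exists>M>0. \<forall>z. z \<noteq> 0 \<longrightarrow> norm z powr Re c \<le> M * norm (zpow lg z c) \<and>
     norm (zpow lg z c) \<le> M * norm z powr Re c"
proof -
  obtain M where M: "\<And>z. z \<noteq> 0 \<Longrightarrow> \<bar>Im (lg z)\<bar> \<le> M" using log_branch_bounded_Im[OF assms] by blast
  define E where "E = exp (\<bar>Im c\<bar> * M)"
  have "norm z powr Re c \<le> E * norm (zpow lg z c) \<and> norm (zpow lg z c) \<le> E * norm z powr Re c"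
    if "z \<noteq> 0" for z
  proof -
    have "\<bar>Im c * Im (lg z)\<bar> \<le> \<bar>Im c\<bar> * M"
      unfolding abs_mult using M[OF that] by (intro mult_left_mono) auto
    hence "1 \<le> E * exp (- (Im c * Im (lg z)))" "exp (- (Im c * Im (lg z))) \<le> E"
      by (simp_all add: E_def exp_add[symmetric])
    from mult_left_mono[OF this(1), of "norm z powr Re c"] mult_left_mono[OF this(2), of "norm z powr Re c"]
    show ?thesis unfolding norm_zpow[OF assms that] by (simp add: mult_ac)
  qed
  moreover have "E > 0" by (simp add: E_def)
  ultimately show ?thesis by blast
qed

lemma eventually_at_infinity_norm_ge: "\<forall>\<^sub>F z in at_infinity. r \<le> norm (z :: complex)"
  by (auto simp: eventually_at_infinity)

lemma powr_norm_bigo: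
  assumes "r \<le> s"
  shows "(\<lambda>z::complex. of_real (norm z powr r) :: complex) \<in> O[at_infinity](\<lambda>z. of_real (norm z powr s))"
  by (rule bigoI[where c = 1])
     (use assms in \<open>auto intro!: powr_mono eventually_mono[OF eventually_at_infinity_norm_ge[of 1]]\<close>)

lemma powr_norm_smallo:
  assumes "r < s"
  shows "(\<lambda>z::complex. of_real (norm z powr r) :: complex) \<in> o[at_infinity](\<lambda>z. of_real (norm z powr s))"
proof -
  have "(\<lambda>x::real. x powr r) \<in> o(\<lambda>x. x powr s)" using assms by real_asymp
  hence "(\<lambda>z::complex. norm z powr r) \<in> o[at_infinity](\<lambda>z. norm z powr s)"
    by (rule landau_o.small.compose[OF _ filterlim_norm_at_top])
  thus ?thesis by (simp add: smallo_def)
qed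

lemma zpow_bigo_powr:
  assumes "log_branch lg"
  shows "(\<lambda>z. zpow lg z c) \<in> O[at_infinity](\<lambda>z. of_real (norm z powr Re c))"
    and "(\<lambda>z. of_real (norm z powr Re c)) \<in> O[at_infinity](\<lambda>z. zpow lg z c)"
proof -
  obtain M where M: "M > 0" "\<And>z. z \<noteq> 0 \<Longrightarrow> norm z powr Re c \<le> M * norm (zpow lg z c)"
     "\<And>z. z \<noteq> 0 \<Longrightarrow> norm (zpow lg z c) \<le> M * norm z powr Re c"
    using norm_zpow_bounds[OF assms] by blast
  have nz: "\<forall>\<^sub>F z in at_infinity. z \<noteq> (0::complex)"
    by (rule eventually_mono[OF eventually_at_infinity_norm_ge[of 1]]) auto
  show "(\<lambda>z. zpow lg z c) \<in> O[at_infinity](\<lambda>z. of_real (norm z powr Re c))"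
    by (rule bigoI[where c = M]) (use M in \<open>auto intro: eventually_mono[OF nz]\<close>)
  show "(\<lambda>z. of_real (norm z powr Re c)) \<in> O[at_infinity](\<lambda>z. zpow lg z c)"
    by (rule bigoI[where c = M]) (use M in \<open>auto intro: eventually_mono[OF nz]\<close>)
qed

context fox_setup
begin

section \<open>From one good cut to the expansion\<close>

text \<open>The real parts of the poles form a countable set, so they cannot fill an
  interval.\<close>

lemma ex_truncation_point: "\<exists>T\<ge>X. \<forall>s\<in>a_poles. Re s \<noteq> T"
proof -
  have "countable (Re ` a_poles)" unfolding a_poles_eq by (intro countable_image countable_SIGMA) auto
  moreover have "uncountable {X..X + 1}" by (rule uncountable_closed_interval[THEN iffD2]) simp
  ultimately have "\<not> {X..X + 1} \<subseteq> Re ` a_poles" using countable_subset by blast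
  thus ?thesis by fastforce
qed

lemma fox_H_finite_expansion:
  "\<exists>T\<ge>X. (\<lambda>z. H z - (\<Sum>t\<in>left_poles T. coeff (fst t) (snd t) * zpow lg z (- pole (fst t) (snd t))))
      \<in> O[at_infinity](\<lambda>z. of_real (norm z powr (- T)))"
proof -
  obtain C X' where C: "\<And>T D z. T \<ge> X' \<Longrightarrow> \<forall>s\<in>a_poles. Re s \<noteq> T \<Longrightarrow>
     \<forall>y\<in>{\<phi>1..\<phi>2}. norm (K (Complex T y)) \<le> D \<Longrightarrow> 1 \<le> norm z \<Longrightarrow>
        norm (H z - (\<Sum>t\<in>left_poles T. coeff (fst t) (snd t) * zpow lg z (- pole (fst t) (snd t))))
          \<le> C * (D + exp (- T)) * norm z powr (- T)"
    using fox_H_truncation unfolding eventually_at_top_linorder by blast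
  obtain X'' where X'': "\<And>T s. T \<ge> X'' \<Longrightarrow> s \<in> b_poles \<Longrightarrow> Re s < T"
    using b_poles_bounded unfolding eventually_at_top_linorder by blast
  obtain T where T: "T \<ge> max X (max X' X'')" "\<forall>s\<in>a_poles. Re s \<noteq> T"
    using ex_truncation_point by blast
  \<comment> \<open>The edge avoids one family of poles by the choice of T and the other because T
    exceeds X''; being compact, it yields D.\<close>
  have "continuous_on {\<phi>1..\<phi>2} (\<lambda>y. K (Complex T y))"
    unfolding Complex_eq
    by (intro continuous_on_compose2[OF holomorphic_on_imp_continuous_on[OF holomorphic_kernel]]
          continuous_intros) (use T X'' in fastforce)
  hence "bounded ((\<lambda>y. K (Complex T y)) ` {\<phi>1..\<phi>2})"
    by (intro compact_imp_bounded compact_continuous_image) auto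
  then obtain D where "\<forall>y\<in>{\<phi>1..\<phi>2}. norm (K (Complex T y)) \<le> D" by (auto simp: bounded_iff)
  hence "\<forall>\<^sub>F z in at_infinity.
      norm (H z - (\<Sum>t\<in>left_poles T. coeff (fst t) (snd t) * zpow lg z (- pole (fst t) (snd t))))
          \<le> C * (D + exp (- T)) * norm (of_real (norm z powr (- T)) :: complex)"
    using C T by (intro eventually_mono[OF eventually_at_infinity_norm_ge[of 1]]) auto
  thus ?thesis using T(1) by (intro exI[of _ T] conjI bigoI) auto
qed

text \<open>With n = 0 no power is left to absorb an error term, so the value has to be exactly 0: the
  truncation bound holds for every large T, with a constant that does not depend on T.\<close>

lemma fox_H_eq_0:
  assumes "n = 0" "1 \<le> norm z"
  shows "H z = 0"
proof -
  obtain C where C: "C \<ge> 0" "\<forall>\<^sub>F T in at_top. (\<forall>s\<in>a_poles. Re s \<noteq> T) \<longrightarrow>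
     (\<forall>D z. (\<forall>y\<in>{\<phi>1..\<phi>2}. norm (K (Complex T y)) \<le> D) \<longrightarrow> 1 \<le> norm z \<longrightarrow>
        norm (H z - (\<Sum>t\<in>left_poles T. coeff (fst t) (snd t) * zpow lg z (- pole (fst t) (snd t))))
          \<le> C * (D + exp (- T)) * norm z powr (- T))"
    using fox_H_truncation by blast
  have no_poles: "a_poles = {}" "left_poles T = {}" for T
    unfolding a_poles_def left_poles_def using assms(1) by simp_all
  have "\<forall>\<^sub>F T in at_top. \<forall>y\<in>{\<phi>1..\<phi>2}. norm (K (Complex T y)) \<le> exp (- T)"
    by (rule kernel_decay) (use assms in auto)
  with C(2) have "\<forall>\<^sub>F T in at_top. norm (H z) \<le> C * (2 * exp (- T))"
    using eventually_ge_at_top[of 0]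
  proof eventually_elim
    case (elim T)
    have "norm (H z - (\<Sum>t\<in>left_poles T. coeff (fst t) (snd t) * zpow lg z (- pole (fst t) (snd t))))
          \<le> C * (exp (- T) + exp (- T)) * norm z powr (- T)"
      using elim(1,2) assms(2) unfolding no_poles by blast
    moreover have "norm z powr (- T) \<le> norm z powr 0" using elim(3) assms by (intro powr_mono) auto
    hence "C * (exp (- T) + exp (- T)) * norm z powr (- T) \<le> C * (exp (- T) + exp (- T)) * 1"
      using C(1) assms(2) by (intro mult_left_mono) (auto split: if_splits)
    ultimately show ?case by (simp add: no_poles)
  qed
  moreover have "((\<lambda>T::real. C * (2 * exp (- T))) \<longlongrightarrow> 0) at_top" by real_asymp
  ultimately have "norm (H z) \<le> 0"
    by (intro tendsto_lowerbound) auto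
  thus ?thesis by simp
qed

lemma exponent_eq_pole: "(a i - of_nat k - 1) / of_real (\<alpha> i) = - pole i k"
  by (simp add: pole_def divide_simps)

lemma fox_H_asymp_power_expansion:
  "asymp_power_expansion lg ({1..n} \<times> UNIV) (\<lambda>(i, k). coeff i k)
     (\<lambda>(i, k). (a i - of_nat k - 1) / of_real (\<alpha> i)) H"
  unfolding asymp_power_expansion_def
proof (intro allI conjI)
  fix \<rho> :: real
  define t where "t = (\<lambda>z u. coeff (fst u) (snd u) * zpow lg z (- pole (fst u) (snd u)))"
  define A where "A = {u \<in> {1..n} \<times> UNIV. Re (pole (fst u) (snd u)) \<le> - \<rho>}"
  have A: "{u \<in> {1..n} \<times> UNIV. \<rho> \<le> Re (case u of (i, k) \<Rightarrow> (a i - of_nat k - 1) / of_real (\<alpha> i))} = A"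
    by (auto simp: A_def exponent_eq_pole)
  \<comment> \<open>The extra 1 makes -T < \<rho> strict: this upgrades O(|z|^(-T)) to o(|z|^\<rho>)
    and puts all terms of order at least \<rho> to the left of the cut. Surplus terms to the left of
    the cut have order strictly below \<rho>.\<close>
  obtain T where T: "T \<ge> - \<rho> + 1"
    "(\<lambda>z. H z - (\<Sum>u\<in>left_poles T. t z u)) \<in> O[at_infinity](\<lambda>z. of_real (norm z powr (- T)))"
    using fox_H_finite_expansion[of "- \<rho> + 1"] unfolding t_def by blast
  have sub: "A \<subseteq> left_poles T" using T(1) by (auto simp: A_def left_poles_def)
  show "finite {u \<in> {1..n} \<times> UNIV. \<rho> \<le> Re (case u of (i, k) \<Rightarrow> (a i - of_nat k - 1) / of_real (\<alpha> i))}"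
    unfolding A by (rule finite_subset[OF sub finite_left_poles])
  have split: "(\<Sum>u\<in>left_poles T. t z u) = (\<Sum>u\<in>left_poles T - A. t z u) + (\<Sum>u\<in>A. t z u)" for z
    by (rule sum.subset_diff[OF sub finite_left_poles])
  have "(\<lambda>z. H z - (\<Sum>u\<in>left_poles T. t z u)) \<in> o[at_infinity](\<lambda>z. of_real (norm z powr \<rho>))"
    by (rule landau_o.big_small_trans[OF T(2) powr_norm_smallo]) (use T(1) in simp)
  moreover have "(\<lambda>z. \<Sum>u\<in>left_poles T - A. t z u) \<in> o[at_infinity](\<lambda>z. of_real (norm z powr \<rho>))"
  proof (rule big_sum_in_smallo)
    fix u assume "u \<in> left_poles T - A"
    hence "Re (- pole (fst u) (snd u)) < \<rho>" by (auto simp: A_def left_poles_def)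
    from landau_o.big_small_trans[OF zpow_bigo_powr(1)[OF branch] powr_norm_smallo[OF this]]
    show "(\<lambda>z. t z u) \<in> o[at_infinity](\<lambda>z. of_real (norm z powr \<rho>))"
      unfolding t_def by (cases "coeff (fst u) (snd u) = 0") auto
  qed
  ultimately have "(\<lambda>z. (H z - (\<Sum>u\<in>left_poles T. t z u)) + (\<Sum>u\<in>left_poles T - A. t z u))
      \<in> o[at_infinity](\<lambda>z. of_real (norm z powr \<rho>))"
    by (rule sum_in_smallo(1))
  also have "(\<lambda>z. (H z - (\<Sum>u\<in>left_poles T. t z u)) + (\<Sum>u\<in>left_poles T - A. t z u)) =
     (\<lambda>z. H z - (\<Sum>u\<in>A. (case u of (i, k) \<Rightarrow> coeff i k) *
        zpow lg z (case u of (i, k) \<Rightarrow> (a i - of_nat k - 1) / of_real (\<alpha> i))))"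
    unfolding split by (auto simp: t_def exponent_eq_pole case_prod_unfold)
  finally show "(\<lambda>z. H z - (\<Sum>u\<in>{u \<in> {1..n} \<times> UNIV. \<rho> \<le> Re (case u of (i, k) \<Rightarrow> (a i - of_nat k - 1) / of_real (\<alpha> i))}.
        (case u of (i, k) \<Rightarrow> coeff i k) *
        zpow lg z (case u of (i, k) \<Rightarrow> (a i - of_nat k - 1) / of_real (\<alpha> i))))
      \<in> o[at_infinity](\<lambda>z. of_real (norm z powr \<rho>))"
    unfolding A .
qed

lemma fox_H_main_terms:
  "\<exists>E. (\<forall>i\<in>{1..n}. E i \<in> O[at_infinity](\<lambda>z. zpow lg z ((a i - 2) / of_real (\<alpha> i)))) \<and>
     (\<forall>\<^sub>F z in at_infinity. H z = (\<Sum>i=1..n. coeff i 0 * zpow lg z ((a i - 1) / of_real (\<alpha> i)) + E i z))"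
proof (cases "n = 0")
  case True
  have "\<forall>\<^sub>F z in at_infinity. H z = 0"
    by (rule eventually_mono[OF eventually_at_infinity_norm_ge[of 1] fox_H_eq_0[OF True]])
  thus ?thesis using True by simp
next
  case False
  define t where "t = (\<lambda>z u. coeff (fst u) (snd u) * zpow lg z (- pole (fst u) (snd u)))"
  \<comment> \<open>With T > X all first two poles of every family lie to the left of the cut, and
    the remainder O(|z|^(-T)) is below |z|^(-Re (pole i 1)), the size of the allowed error, for
    every i at once.\<close>
  define X where "X = Max ((\<lambda>i. Re (pole i 1)) ` {1..n})"
  have X: "Re (pole i 1) \<le> X" if "i \<in> {1..n}" for i unfolding X_def using that by (intro Max_ge) auto
  have pole_mono: "Re (pole i k) \<le> Re (pole i l)" if "i \<in> {1..n}" "k \<le> l" for i k l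
    using that param_pos(1)[OF that(1)]
    by (simp add: pole_def Re_divide_of_real divide_right_mono)
  obtain T where T: "T \<ge> X + 1"
    "(\<lambda>z. H z - (\<Sum>u\<in>left_poles T. t z u)) \<in> O[at_infinity](\<lambda>z. of_real (norm z powr (- T)))"
    using fox_H_finite_expansion[of "X + 1"] unfolding t_def by blast
  define ks where "ks = (\<lambda>i. {k. Re (pole i k) < T})"
  have left: "left_poles T = Sigma {1..n} ks" by (auto simp: left_poles_def ks_def)
  have fin: "finite (ks i)" if "i \<in> {1..n}" for i
  proof -
    have "ks i = Pair i -` left_poles T" using that by (auto simp: left)
    thus ?thesis using finite_left_poles by (simp add: finite_vimageI inj_on_def)
  qed
  have k0: "0 \<in> ks i" if "i \<in> {1..n}" for i
    using pole_mono[OF that, of 0 1] X[OF that] T(1) by (simp add: ks_def)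
  \<comment> \<open>The remainder of the truncation belongs to no particular i, so each of the n
    error terms takes an equal share of it; this needs n > 0.\<close>
  define E where "E = (\<lambda>i z. (\<Sum>k\<in>ks i - {0}. t z (i, k)) +
      1 / of_nat n * (H z - (\<Sum>u\<in>left_poles T. t z u)))"
  have bigo: "E i \<in> O[at_infinity](\<lambda>z. zpow lg z ((a i - 2) / of_real (\<alpha> i)))" if i: "i \<in> {1..n}" for i
  proof -
    have e: "(a i - 2) / of_real (\<alpha> i) = - pole i 1"
      using exponent_eq_pole[of i 1] by simp
    have "(\<lambda>z. t z (i, k)) \<in> O[at_infinity](\<lambda>z. of_real (norm z powr Re (- pole i 1)))"
      if k: "k \<in> ks i - {0}" for k
    proof -
      have "Re (- pole i k) \<le> Re (- pole i 1)" using pole_mono[OF i, of 1 k] k by simp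
      from landau_o.big_trans[OF zpow_bigo_powr(1)[OF branch] powr_norm_bigo[OF this]]
      show ?thesis unfolding t_def by (cases "coeff i k = 0") auto
    qed
    hence "(\<lambda>z. \<Sum>k\<in>ks i - {0}. t z (i, k)) \<in> O[at_infinity](\<lambda>z. of_real (norm z powr Re (- pole i 1)))"
      by (rule big_sum_in_bigo)
    moreover have "(\<lambda>z. 1 / of_nat n * (H z - (\<Sum>u\<in>left_poles T. t z u)))
        \<in> O[at_infinity](\<lambda>z. of_real (norm z powr Re (- pole i 1)))"
      using landau_o.big_trans[OF T(2) powr_norm_bigo[of "- T" "Re (- pole i 1)"]] X[OF i] T(1) False
      by (subst landau_o.big.cmult_in_iff) auto
    ultimately have "E i \<in> O[at_infinity](\<lambda>z. of_real (norm z powr Re (- pole i 1)))"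
      unfolding E_def by (rule sum_in_bigo(1))
    from landau_o.big_trans[OF this zpow_bigo_powr(2)[OF branch]] show ?thesis unfolding e .
  qed
  have "H z = (\<Sum>i=1..n. coeff i 0 * zpow lg z ((a i - 1) / of_real (\<alpha> i)) + E i z)" for z
  proof -
    have "(\<Sum>u\<in>left_poles T. t z u) = (\<Sum>i=1..n. \<Sum>k\<in>ks i. t z (i, k))"
      unfolding left using fin by (subst sum.Sigma) (auto simp: case_prod_unfold)
    also have "\<dots> = (\<Sum>i=1..n. t z (i, 0) + (\<Sum>k\<in>ks i - {0}. t z (i, k)))"
      using fin k0 by (intro sum.cong refl sum.remove) auto
    finally have "(\<Sum>i=1..n. t z (i, 0) + E i z) =
        (\<Sum>u\<in>left_poles T. t z u) + of_nat n * (1 / of_nat n * (H z - (\<Sum>u\<in>left_poles T. t z u)))"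
      unfolding E_def by (simp add: sum.distrib flip: add.assoc)
    moreover have "t z (i, 0) = coeff i 0 * zpow lg z ((a i - 1) / of_real (\<alpha> i))" for i
      using exponent_eq_pole[of i 0] by (simp add: t_def)
    ultimately show ?thesis using False by simp
  qed
  thus ?thesis using bigo by (intro exI[of _ E]) auto
qed

end

theorem corollary4:
  fixes m n p q :: nat
    and a b :: "nat \<Rightarrow> complex"
    and \<alpha> \<beta> :: "nat \<Rightarrow> real"
    and lg :: "complex \<Rightarrow> complex"
    and \<phi>1 \<phi>2 R :: real
    and \<gamma> :: "real \<Rightarrow> complex"
  assumes "m \<le> q" and "n \<le> p"
    and "\<forall>i\<in>{1..p}. \<alpha> i > 0"
    and "\<forall>j\<in>{1..q}. \<beta> j > 0"
    and "\<forall>i\<in>{1..n}. \<forall>j\<in>{1..m}. \<forall>k l :: nat.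
           of_real (\<beta> j) * (a i - 1 - of_nat k) \<noteq> of_real (\<alpha> i) * (b j + of_nat l)"
    and "\<forall>i\<in>{1..n}. \<forall>j\<in>{1..n}. i \<noteq> j \<longrightarrow> (\<forall>k l :: nat.
           of_real (\<alpha> j) * (1 - a i + of_nat k) \<noteq> of_real (\<alpha> i) * (1 - a j + of_nat l))"
    and "fox_Delta p q \<alpha> \<beta> < 0"
    and "log_branch lg"
    and "fox_loop m n a \<alpha> b \<beta> \<phi>1 \<phi>2 R \<gamma>"
  shows "asymp_power_expansion lg ({1..n} \<times> UNIV)
           (\<lambda>(i, k). fox_coeff m n p q a \<alpha> b \<beta> i k)
           (\<lambda>(i, k). (a i - of_nat k - 1) / of_real (\<alpha> i))
           (fox_H m n p q a \<alpha> b \<beta> \<phi>1 \<phi>2 R \<gamma> lg) \<and>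
         (\<exists>E. (\<forall>i\<in>{1..n}. E i \<in> O[at_infinity](\<lambda>z. zpow lg z ((a i - 2) / of_real (\<alpha> i)))) \<and>
           (\<forall>\<^sub>F z in at_infinity.
              fox_H m n p q a \<alpha> b \<beta> \<phi>1 \<phi>2 R \<gamma> lg z =
              (\<Sum>i=1..n. fox_coeff m n p q a \<alpha> b \<beta> i 0 * zpow lg z ((a i - 1) / of_real (\<alpha> i)) + E i z))) \<and>
         (\<forall>i\<in>{1..n}. fox_coeff m n p q a \<alpha> b \<beta> i 0 =
           1 / of_real (\<alpha> i) *
           (\<Prod>j=1..m. Gamma (b j - (a i - 1) * of_real (\<beta> j / \<alpha> i))) *
           (\<Prod>j\<in>{1..n} - {i}. Gamma (1 - a j + (a i - 1) * of_real (\<alpha> j / \<alpha> i))) *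
           (\<Prod>j=n+1..p. rGamma (a j - (a i - 1) * of_real (\<alpha> j / \<alpha> i))) *
           (\<Prod>j=m+1..q. rGamma (1 - b j + (a i - 1) * of_real (\<beta> j / \<alpha> i))))"
proof -
  have "infinite_loop \<phi>1 \<phi>2 R \<gamma>" using assms(9) by (simp add: fox_loop_def)
  interpret fox_setup \<phi>1 \<phi>2 R \<gamma> m n p q a b \<alpha> \<beta> lg
    by unfold_locales (rule assms \<open>infinite_loop \<phi>1 \<phi>2 R \<gamma>\<close>)+
  \<comment> \<open>\<open>of_nat 0\<close> stays unevaluated so that the rewritten arguments agree
    literally with the unfolded coefficient at k = 0.\<close>
  have "x - (a i - 1) * c = x + (1 - a i + of_nat 0) * c" "x + (a i - 1) * c = x - (1 - a i + of_nat 0) * c"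
    for x c i by (simp_all add: algebra_simps)
  hence "fox_coeff m n p q a \<alpha> b \<beta> i 0 =
           1 / of_real (\<alpha> i) *
           (\<Prod>j=1..m. Gamma (b j - (a i - 1) * of_real (\<beta> j / \<alpha> i))) *
           (\<Prod>j\<in>{1..n} - {i}. Gamma (1 - a j + (a i - 1) * of_real (\<alpha> j / \<alpha> i))) *
           (\<Prod>j=n+1..p. rGamma (a j - (a i - 1) * of_real (\<alpha> j / \<alpha> i))) *
           (\<Prod>j=m+1..q. rGamma (1 - b j + (a i - 1) * of_real (\<beta> j / \<alpha> i)))" for i
    by (simp only: fox_coeff_def power_0 fact_0 mult_1)
  thus ?thesis using fox_H_asymp_power_expansion fox_H_main_terms by blast
qed

end
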